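(* Let $(i,j)\in\mathbb{Z}^2\setminus\mathcal H$. There exist Laurent polynomials $f(z)$ with coefficients in $\mathbb{Q}$ and $g(z)$ with coefficients in $\mathbb{Q}[\sqrt2]$, with $f(1)=1$ and $g(1)\ne0$, such that $$\sum_{k\ge0}p^{[k]}_{i,j}z^k=f(z)-g(z)\sqrt{(1-z)\left(1-z(\sqrt2-1)^2\right)}.$$ Consequently, as $k\to\infty$, $$p^{[k]}_{i,j}\sim g(1)\sqrt{\frac{\sqrt2-1}{2\pi}}\,k^{-3/2},\qquad \sum_{\ell\ge k}p^{[\ell]}_{i,j}\sim g(1)\sqrt{\frac{2(\sqrt2-1)}{\pi}}\,k^{-1/2}.$$ For $(i,j)=(1,0)$ one has $f(z)=g(z)=1/z$ (so $g(1)=1$).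
   Context: $\mathcal H=\{(k,0):k\in\mathbb{Z},k\le0\}$. Let $(W_n)_{n\ge0}$ be the simple random walk on $\mathbb{Z}^2$ (each step uniform in $\{(\pm1,0),(0,\pm1)\}$) started at $W_0=(i,j)\notin\mathcal H$, and $\tau=\min\{n\ge0:W_n\in\mathcal H\}$ (finite almost surely). $p^{[k]}_{i,j}=\Pr(W_\tau=(-k,0))$ for $k\ge0$. The square root is the branch equal to $1$ at $z=0$, and the series converges for $|z|\le1$. *)

theory Defs
  imports "HOL-Analysis.Analysis" "HOL-Computational_Algebra.Polynomial" "HOL-Library.Landau_Symbols"
begin

definition Hset :: "(int \<times> int) set" where
  "Hset = {(k, 0) | k. k \<le> 0}"

text \<open>first_hit n s t = Pr(tau = n and W_tau = t) for the simple random walk started at s,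
  where tau is the first hitting time of Hset (first-step decomposition).\<close>
fun first_hit :: "nat \<Rightarrow> int \<times> int \<Rightarrow> int \<times> int \<Rightarrow> real" where
  "first_hit 0 s t = (if s \<in> Hset \<and> s = t then 1 else 0)"
| "first_hit (Suc n) s t =
     (if s \<in> Hset then 0
      else (first_hit n (fst s + 1, snd s) t + first_hit n (fst s - 1, snd s) t
          + first_hit n (fst s, snd s + 1) t + first_hit n (fst s, snd s - 1) t) / 4)"

text \<open>p^[k]_{i,j} = Pr(W_tau = (-k,0)) = sum over n of Pr(tau = n, W_n = (-k,0)).\<close>
definition hitp :: "int \<Rightarrow> int \<Rightarrow> nat \<Rightarrow> real" where
  "hitp i j k = (\<Sum>n. first_hit n (i, j) (- int k, 0))"

definition laurent_eval :: "int \<Rightarrow> real poly \<Rightarrow> 'a::real_normed_field \<Rightarrow> 'a" where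
  "laurent_eval m P z = poly (map_poly of_real P) z * z powi m"

definition QSqrt2 :: "real set" where
  "QSqrt2 = {of_rat a + of_rat b * sqrt 2 | a b. True}"

end

theory Submission
  imports Defs "HOL-Real_Asymp.Real_Asymp"
begin

text \<open>
  Write \<open>S(z) = \<surd>((1 - z)(1 - \<alpha>z))\<close> with \<open>\<alpha> = (\<surd>2 - 1)\<^sup>2\<close>. A bounded function that is harmonic off the slit is
  determined in each half-plane by its values on the axis, through the discrete Poisson kernel. On the axis, harmonicity
  is therefore a convolution equation, whose kernel has the symbol
  \<open>\<surd>((4 - w - 1/w)\<^sup>2 - 4) = (\<surd>2 + 1) S(w) S(1/w)\<close> for \<open>|w| = 1\<close>. This Wiener--Hopf factorisation solves the
  equation explicitly: the generating function of the walk started at \<open>(m, 0)\<close> is \<open>S(x)\<close> times the coefficient of \<open>w\<^sup>m\<close>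
  in \<open>1 / (S(w) (1 - x/w))\<close>. It yields the row \<open>j = 0\<close> and, through the value of the convolution at \<open>m \<le> 0\<close>, the row
  \<open>j = 1\<close>; harmonicity gives the other rows, all of the form \<open>f - g S\<close>. The numbers \<open>g(1)\<close> form a nonnegative
  function that is harmonic off the slit and takes the value 1 at \<open>(1, 0)\<close>, hence it does not vanish there.
\<close>

section \<open>The series of the square root\<close>

unbundle no vec_syntax
unbundle fps_syntax

text \<open>The constants come from \<open>(4 - w - 1/w)^2 - 4 = (2 - w - 1/w)(6 - w - 1/w)\<close>:
  the first factor is \<open>(1 - w)(1 - 1/w)\<close>, the second is
  \<open>(1 - alpha w)(1 - alpha/w) / alpha\<close> because \<open>alpha + 1/alpha = 6\<close>, and
  \<open>1 / sqrt alpha = sqrt 2 + 1\<close>. The closed form works because multiplying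
  \<open>1 / (S(w) (1 - x/w))\<close> by \<open>S(w) S(1/w)\<close> leaves
  \<open>S(1/w) / (1 - x/w)\<close>, which has no positive powers of \<open>w\<close>, so the
  convolution vanishes for \<open>m > 0\<close>; and for \<open>m <= 0\<close> the coefficient of
  \<open>w^m\<close> is \<open>x^(-m) / S(x)\<close>, the boundary data up to the factor
  \<open>S(x)\<close>. The obstacle is the zero of the symbol at \<open>w = 1\<close>. It prevents
  inverting the kernel among summable sequences: \<open>1/S\<close> has coefficients of order
  \<open>n^(-1/2)\<close>, which tend to 0 but are not summable. Infinite double sums therefore pair
  summable kernels with merely bounded functions, and uniqueness comes from a maximum principle. The
  identities are proved for real \<open>x\<close> in (0, 1) only, then turned into identities
  between coefficients, which give the closed complex disc and the asymptotics.\<close>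

definition binom_fps :: "real \<Rightarrow> real \<Rightarrow> real fps" where
  "binom_fps c a = Abs_fps (\<lambda>n. (c gchoose n) * (- a) ^ n)"

text \<open>\<open>binom_fps c a\<close> is the series of \<open>(1 - a X)^c\<close>, so this law of
  exponents is the Vandermonde convolution; it yields both squares of square roots and
  inverses.\<close>

lemma binom_fps_mult: "binom_fps c a * binom_fps d a = binom_fps (c + d) a"
proof (rule fps_ext)
  fix n
  have "(binom_fps c a * binom_fps d a) $ n
      = (\<Sum>k=0..n. (c gchoose k) * (d gchoose (n - k)) * (- a) ^ n)"
    unfolding fps_mult_nth
  proof (rule sum.cong[OF refl])
    fix k assume "k \<in> {0..n}"
    then have "(- a) ^ n = (- a) ^ k * (- a) ^ (n - k)" by (simp flip: power_add)
    then show "binom_fps c a $ k * binom_fps d a $ (n - k)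
        = (c gchoose k) * (d gchoose (n - k)) * (- a) ^ n"
      by (simp only: binom_fps_def fps_nth_Abs_fps mult_ac)
  qed
  also have "\<dots> = binom_fps (c + d) a $ n"
    by (simp add: binom_fps_def gbinomial_Vandermonde flip: sum_distrib_right)
  finally show "(binom_fps c a * binom_fps d a) $ n = binom_fps (c + d) a $ n" .
qed

lemma binom_fps_0: "binom_fps 0 a = 1"
  by (rule fps_ext) (auto simp: binom_fps_def gbinomial_0_left)

lemma binom_fps_1: "binom_fps 1 a = 1 - fps_const a * fps_X"
proof (rule fps_ext)
  fix n
  have "(1::real) gchoose n = (if n \<le> 1 then 1 else 0)"
    using binomial_gbinomial[of 1 n, where ?'a = real] by (cases "n \<le> 1") (auto simp: le_Suc_eq binomial_eq_0)
  then show "binom_fps 1 a $ n = (1 - fps_const a * fps_X) $ n"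
    by (cases n) (auto simp: binom_fps_def)
qed

text \<open>Classical asymptotics of binomial coefficients. The weight \<open>n + 1\<close> replaces
  the usual \<open>n\<close> because it is nonzero at \<open>n = 0\<close> and its powers are
  submultiplicative along \<open>n = k + (n - k)\<close>.\<close>

lemma binom_fps_asymp:
  "(\<lambda>n. binom_fps c 1 $ n * real (n + 1) powr (c + 1)) \<longlonglongrightarrow> inverse (Gamma (- c))"
proof -
  have "(\<lambda>n. (c gchoose n) / ((-1)^n / exp ((c+1) * ln (real n))) * (real (n + 1) / real n) powr (c + 1))
      \<longlonglongrightarrow> inverse (Gamma (- c)) * 1 powr (c + 1)"
  proof (intro tendsto_mult)
    show "(\<lambda>n. (c gchoose n) / ((-1)^n / exp ((c+1) * ln (real n)))) \<longlonglongrightarrow> inverse (Gamma (- c))"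
      using gbinomial_asymptotic[of c] by simp
    have "(\<lambda>n. real (n + 1) / real n) \<longlonglongrightarrow> 1" by real_asymp
    then show "(\<lambda>n. (real (n + 1) / real n) powr (c + 1)) \<longlonglongrightarrow> 1 powr (c + 1)"
      by (intro tendsto_powr tendsto_const) auto
  qed
  moreover have "eventually (\<lambda>n. (c gchoose n) / ((-1)^n / exp ((c+1) * ln (real n)))
      * (real (n + 1) / real n) powr (c + 1) = binom_fps c 1 $ n * real (n + 1) powr (c + 1)) sequentially"
    using eventually_gt_at_top[of 0]
  proof eventually_elim
    case (elim n)
    have "exp ((c+1) * ln (real n)) = real n powr (c + 1)" using elim by (simp add: powr_def)
    moreover have "(-1::real) ^ n * (-1) ^ n = 1" by (simp flip: power_add power_mult_distrib)
    then have "inverse ((-1::real) ^ n) = (-1) ^ n" by (metis inverse_unique)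
    moreover have "real n powr (c + 1) * (real (n + 1) / real n) powr (c + 1) = real (n + 1) powr (c + 1)"
      using elim by (simp add: powr_mult[symmetric])
    ultimately show ?case
      by (simp add: binom_fps_def divide_inverse mult_ac)
  qed
  ultimately show ?thesis by (simp add: filterlim_cong)
qed

section \<open>Coefficient asymptotics of products\<close>

lemma powr_Suc_submult:
  assumes "k \<le> n" "t \<ge> 0"
  shows "real (n + 1) powr t \<le> real (k + 1) powr t * real (n - k + 1) powr t"
proof -
  obtain m where "n = k + m" using assms(1) le_Suc_ex by blast
  then have "real (n + 1) \<le> real (k + 1) * real (n - k + 1)" by (simp add: algebra_simps)
  then have "real (n + 1) powr t \<le> (real (k + 1) * real (n - k + 1)) powr t"
    using assms(2) by (intro powr_mono2) auto
  then show ?thesis by (simp add: powr_mult)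
qed

text \<open>Dominated convergence: for fixed \<open>k\<close> the term
  \<open>g $ k * f $ (n - k)\<close>, weighted at \<open>n\<close>, tends to
  \<open>g $ k * L\<close>, and submultiplicativity of the weight bounds it by a constant times
  \<open>g $ k\<close> weighted at \<open>k\<close>. A factor with faster decaying coefficients thus
  contributes only its value at 1.\<close>

lemma fps_mult_weighted_limit:
  fixes f g :: "real fps"
  assumes t: "t \<ge> 0"
    and f: "(\<lambda>n. f $ n * real (n + 1) powr t) \<longlonglongrightarrow> L"
    and g: "summable (\<lambda>n. \<bar>g $ n\<bar> * real (n + 1) powr t)"
  shows "(\<lambda>n. (f * g) $ n * real (n + 1) powr t) \<longlonglongrightarrow> L * (\<Sum>n. g $ n)"
proof -
  define w where "w n = real (n + 1) powr t" for n
  have wpos: "w n > 0" for n by (simp add: w_def)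
  define a where "a k n = (if k \<le> n then g $ k * f $ (n - k) * w n else 0)" for k n
  obtain C where C: "\<And>n. \<bar>f $ n * w n\<bar> \<le> C"
    using convergent_imp_Bseq[OF convergentI[OF f]] unfolding Bseq_def w_def by auto
  have lim: "(\<lambda>n. a k n) \<longlonglongrightarrow> g $ k * L" for k
  proof -
    \<comment> \<open>Reading the sequence at \<open>n + k\<close> removes the case distinction from
      \<open>a k\<close>.\<close>
    have "(\<lambda>n. g $ k * ((f $ n * w n) * (real (n + k + 1) / real (n + 1)) powr t)) \<longlonglongrightarrow> g $ k * (L * 1 powr t)"
    proof (intro tendsto_intros)
      show "(\<lambda>n. f $ n * w n) \<longlonglongrightarrow> L" using f by (simp add: w_def)
      show "(\<lambda>n. real (n + k + 1) / real (n + 1)) \<longlonglongrightarrow> 1" by real_asymp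
    qed auto
    also have "(\<lambda>n. g $ k * ((f $ n * w n) * (real (n + k + 1) / real (n + 1)) powr t)) = (\<lambda>n. a k (n + k))"
    proof
      fix n
      have "w n * (real (n + k + 1) / real (n + 1)) powr t = w (n + k)"
        by (simp add: w_def powr_divide)
      then show "g $ k * ((f $ n * w n) * (real (n + k + 1) / real (n + 1)) powr t) = a k (n + k)"
        by (simp add: a_def mult.assoc)
    qed
    finally show ?thesis by (simp add: LIMSEQ_offset)
  qed
  have bound: "norm (a k n) \<le> C * (\<bar>g $ k\<bar> * w k)" for k n
  proof (cases "k \<le> n")
    case True
    have "\<bar>f $ (n - k)\<bar> * w n \<le> \<bar>f $ (n - k)\<bar> * (w k * w (n - k))"
      using powr_Suc_submult[OF True t] by (intro mult_left_mono) (auto simp: w_def)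
    also have "\<dots> = w k * \<bar>f $ (n - k) * w (n - k)\<bar>"
      using wpos[of "n-k"] by (simp add: abs_mult)
    also have "\<dots> \<le> w k * C" using C[of "n - k"] wpos[of k] by (intro mult_left_mono) auto
    finally have "\<bar>g $ k\<bar> * (\<bar>f $ (n - k)\<bar> * w n) \<le> \<bar>g $ k\<bar> * (w k * C)"
      by (rule mult_left_mono) simp
    then show ?thesis using True wpos[of n] by (simp add: a_def abs_mult mult_ac)
  next
    case False
    have "0 \<le> C" using C[of 0] by linarith
    then show ?thesis using False wpos[of k] by (simp add: a_def)
  qed
  have "(\<lambda>n. \<Sum>k. a k n) \<longlonglongrightarrow> (\<Sum>k. g $ k * L)"
    by (rule tannerys_theorem[where M = "\<lambda>k. C * (\<bar>g $ k\<bar> * w k)", THEN conjunct2, THEN conjunct2])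
      (use lim bound g in \<open>auto simp: w_def intro!: always_eventually\<close>)
  also have "(\<Sum>k. g $ k * L) = (\<Sum>k. g $ k) * L"
  proof (rule suminf_mult2[symmetric], rule summable_comparison_test'[OF g])
    fix n :: nat
    have "1 \<le> w n" using t by (simp add: w_def ge_one_powr_ge_zero)
    then show "norm (g $ n) \<le> \<bar>g $ n\<bar> * real (n + 1) powr t"
      unfolding w_def[symmetric] by (simp add: mult_le_cancel_left1)
  qed
  also have "(\<lambda>n. \<Sum>k. a k n) = (\<lambda>n. (f * g) $ n * w n)"
  proof
    fix n
    have "(\<Sum>k. a k n) = (\<Sum>k\<in>{0..n}. a k n)" by (rule suminf_finite) (auto simp: a_def)
    also have "\<dots> = (g * f) $ n * w n"
      unfolding fps_mult_nth sum_distrib_right by (rule sum.cong) (auto simp: a_def)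
    finally show "(\<Sum>k. a k n) = (f * g) $ n * w n" by (simp add: mult.commute)
  qed
  finally show ?thesis by (simp add: w_def mult.commute)
qed

text \<open>The coefficients are those of \<open>(1 - X)^c\<close>, bounded by a power of
  \<open>n + 1\<close>, times \<open>a^n\<close>.\<close>

lemma summable_binom_fps_weighted:
  assumes "\<bar>a\<bar> < 1" "t \<ge> 0"
  shows "summable (\<lambda>n. \<bar>binom_fps c a $ n\<bar> * real (n + 1) powr t)"
proof (cases "a = 0")
  case True
  have "summable (\<lambda>n. if n = 0 then (1::real) else 0)" by simp
  moreover have "(\<lambda>n. \<bar>binom_fps c a $ n\<bar> * real (n + 1) powr t) = (\<lambda>n. if n = 0 then (1::real) else 0)"
    using True by (auto simp: binom_fps_def power_0_left)
  ultimately show ?thesis by simp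
next
  case False
  obtain C where C: "\<And>n. \<bar>binom_fps c 1 $ n * real (n + 1) powr (c + 1)\<bar> \<le> C"
    using convergent_imp_Bseq[OF convergentI[OF binom_fps_asymp[of c]]] unfolding Bseq_def by auto
  have "(\<lambda>n. real (n + 1) powr (t - (c + 1)) * \<bar>a\<bar> ^ n) \<in> O(\<lambda>n. sqrt \<bar>a\<bar> ^ n)"
  proof -
    \<comment> \<open>Since \<open>|a| = b * b\<close>, one factor \<open>b ^ n\<close> absorbs the
      power of \<open>n + 1\<close> and the other remains as geometric majorant.\<close>
    define b where "b = sqrt \<bar>a\<bar>"
    have b: "0 < b" "b < 1" "\<bar>a\<bar> = b * b" using False assms(1) by (auto simp: b_def)
    have "(\<lambda>n. real (n + 1) powr (t - (c + 1)) * b ^ n) \<longlonglongrightarrow> 0"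
      using b by real_asymp
    then have "(\<lambda>n. real (n + 1) powr (t - (c + 1)) * b ^ n) \<in> O(\<lambda>n. 1)"
      by (intro bigoI_tendsto[where c = 0]) auto
    then have "(\<lambda>n. (real (n + 1) powr (t - (c + 1)) * b ^ n) * b ^ n) \<in> O(\<lambda>n. 1 * b ^ n)"
      by (rule landau_o.big.mult) simp
    then show ?thesis using b by (simp add: b_def[symmetric] power_mult_distrib mult.assoc)
  qed
  then have "summable (\<lambda>n. real (n + 1) powr (t - (c + 1)) * \<bar>a\<bar> ^ n)"
    by (rule summable_comparison_test_bigo[rotated]) (use assms(1) in \<open>simp add: summable_geometric power_abs\<close>)
  then have "summable (\<lambda>n. C * (real (n + 1) powr (t - (c + 1)) * \<bar>a\<bar> ^ n))"
    by (rule summable_mult)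
  then show ?thesis
  proof (rule summable_comparison_test'[where N = 0])
    fix n :: nat
    have "\<bar>binom_fps c a $ n\<bar> = \<bar>binom_fps c 1 $ n\<bar> * \<bar>a\<bar> ^ n"
      by (simp add: binom_fps_def abs_mult power_abs)
    also have "\<dots> * real (n + 1) powr t
       = \<bar>binom_fps c 1 $ n * real (n + 1) powr (c + 1)\<bar> * (real (n + 1) powr (t - (c + 1)) * \<bar>a\<bar> ^ n)"
      by (simp add: abs_mult powr_diff)
    also have "\<dots> \<le> C * (real (n + 1) powr (t - (c + 1)) * \<bar>a\<bar> ^ n)"
      by (rule mult_right_mono[OF C]) simp
    finally show "norm (\<bar>binom_fps c a $ n\<bar> * real (n + 1) powr t)
        \<le> C * (real (n + 1) powr (t - (c + 1)) * \<bar>a\<bar> ^ n)" by (simp add: abs_mult)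
  qed
qed


section \<open>The constant alpha, the series S and its inverse R\<close>

definition alpha :: real where
  "alpha = (sqrt 2 - 1)\<^sup>2"

lemma alpha_eq: "alpha = 3 - 2 * sqrt 2"
  by (simp add: alpha_def power2_eq_square algebra_simps)

lemma alpha_square: "alpha * alpha = 6 * alpha - 1"
  by (simp add: alpha_eq algebra_simps)

lemma alpha_pos: "0 < alpha"
  by (simp add: alpha_def)

lemma alpha_less_1: "alpha < 1"
proof -
  have "1 < sqrt 2" by simp
  then show ?thesis by (simp add: alpha_eq)
qed

definition S_fps :: "real fps" where
  "S_fps = binom_fps (1/2) 1 * binom_fps (1/2) alpha"

definition R_fps :: "real fps" where
  "R_fps = binom_fps (-1/2) 1 * binom_fps (-1/2) alpha"

lemma S_fps_times_R_fps: "S_fps * R_fps = 1"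
proof -
  have "S_fps * R_fps = (binom_fps (1/2) 1 * binom_fps (-1/2) 1) * (binom_fps (1/2) alpha * binom_fps (-1/2) alpha)"
    by (simp add: S_fps_def R_fps_def mult_ac)
  then show ?thesis by (simp add: binom_fps_mult binom_fps_0)
qed

lemma R_fps_0: "R_fps $ 0 = 1"
  by (simp add: R_fps_def binom_fps_def)

lemma summable_of_weighted_limit:
  fixes f :: "real fps"
  assumes "(\<lambda>n. f $ n * real (n + 1) powr t) \<longlonglongrightarrow> L" "t > 1"
  shows "summable (\<lambda>n. \<bar>f $ n\<bar>)"
proof -
  obtain C where C: "\<And>n. \<bar>f $ n * real (n + 1) powr t\<bar> \<le> C"
    using convergent_imp_Bseq[OF convergentI[OF assms(1)]] unfolding Bseq_def by auto
  have "summable (\<lambda>n. real n powr (-t))" using assms(2) by (simp add: summable_real_powr_iff)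
  then have "summable (\<lambda>n. real (n + 1) powr (-t))" 
    by (subst summable_iff_shift[of "\<lambda>n. real n powr (-t)" 1])
  then have "summable (\<lambda>n. C * real (n + 1) powr (-t))" by (rule summable_mult)
  then show ?thesis
  proof (rule summable_comparison_test'[where N = 0])
    fix n :: nat
    have "\<bar>f $ n\<bar> = \<bar>f $ n * real (n + 1) powr t\<bar> * real (n + 1) powr (-t)"
      by (simp add: abs_mult powr_minus)
    also have "\<dots> \<le> C * real (n + 1) powr (-t)" by (rule mult_right_mono[OF C]) simp
    finally show "norm \<bar>f $ n\<bar> \<le> C * real (n + 1) powr (-t)" by simp
  qed
qed

lemma summable_binom_fps:
  assumes "0 \<le> a" "a \<le> 1"
  shows "summable (\<lambda>n. \<bar>binom_fps (1/2) a $ n\<bar>)"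
proof (cases "a = 1")
  case True
  then show ?thesis using summable_of_weighted_limit[OF binom_fps_asymp[of "1/2"]] by simp
next
  case False
  then show ?thesis using summable_binom_fps_weighted[of a 0 "1/2"] assms by simp
qed

section \<open>Evaluation on the closed unit disc and choice of the branch\<close>

lemma summable_norm_fps_power:
  fixes z :: "'a :: {real_normed_field, banach}"
  assumes f: "summable (\<lambda>n. \<bar>f $ n\<bar>)" and z: "norm z \<le> 1"
  shows "summable (\<lambda>n. norm (of_real (f $ n) * z ^ n))"
proof (rule summable_comparison_test'[OF f])
  fix n
  have "norm z ^ n \<le> 1" using z by (simp add: power_le_one)
  then show "norm (norm (of_real (f $ n) * z ^ n)) \<le> \<bar>f $ n\<bar>"
    by (simp add: norm_mult norm_power mult_left_le)
qed

text \<open>Absolutely summable coefficients make Cauchy products valid up to the unit circle, where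
  the Fourier argument takes place.\<close>

lemma sums_fps_mult:
  fixes z :: "'a :: {real_normed_field, banach}"
  assumes f: "summable (\<lambda>n. \<bar>f $ n\<bar>)" and g: "summable (\<lambda>n. \<bar>g $ n\<bar>)" and z: "norm z \<le> 1"
  shows "(\<lambda>n. of_real ((f * g) $ n) * z ^ n) sums
     ((\<Sum>n. of_real (f $ n) * z ^ n) * (\<Sum>n. of_real (g $ n) * z ^ n))"
proof -
  have "(\<Sum>i\<le>n. of_real (f $ i) * z ^ i * (of_real (g $ (n - i)) * z ^ (n - i)))
      = of_real ((f * g) $ n) * z ^ n" for n
  proof -
    have "of_real (f $ i) * z ^ i * (of_real (g $ (n - i)) * z ^ (n - i))
        = of_real (f $ i * g $ (n - i)) * z ^ n" if "i \<le> n" for i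
    proof -
      have "z ^ n = z ^ i * z ^ (n - i)" using that by (simp flip: power_add)
      then show ?thesis by simp
    qed
    then show ?thesis
      unfolding fps_mult_nth of_real_sum sum_distrib_right atLeast0AtMost by (intro sum.cong) auto
  qed
  then show ?thesis
    using Cauchy_product_sums[OF summable_norm_fps_power[OF f z] summable_norm_fps_power[OF g z]] by simp
qed

lemma sums_fps_linear: "(\<lambda>n. of_real ((1 - fps_const a * fps_X) $ n) * z ^ n) sums (1 - of_real a * (z :: 'a :: {real_normed_field}))"
proof -
  have "(\<lambda>n. of_real ((1 - fps_const a * fps_X) $ n) * z ^ n) sums
     (\<Sum>n<2. of_real ((1 - fps_const a * fps_X) $ n) * z ^ n)"
  proof (rule sums_finite)
    show "of_real ((1 - fps_const a * fps_X) $ n) * z ^ n = 0" if "n \<notin> {..<2}" for n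
      using that by (cases n) (auto simp: fps_X_def numeral_2_eq_2)
  qed simp
  then show ?thesis by (simp add: numeral_2_eq_2)
qed

lemma sqrt_series_square:
  fixes z :: complex
  assumes "0 \<le> a" "a \<le> 1" "norm z \<le> 1"
  shows "(\<Sum>n. of_real (binom_fps (1/2) a $ n) * z ^ n)\<^sup>2 = 1 - of_real a * z"
  using sums_unique2[OF sums_fps_mult[OF summable_binom_fps[OF assms(1,2)] summable_binom_fps[OF assms(1,2)] assms(3)],
      of "1 - of_real a * z"] sums_fps_linear[of a z]
  by (simp add: power2_eq_square binom_fps_mult binom_fps_1)

text \<open>Consecutive coefficients have the nonnegative ratio \<open>(n + 1/2) / (n + 2)\<close>,
  so the sign of the first one, \<open>-1/2\<close>, persists.\<close>

lemma sqrt_coeff_nonpos: "binom_fps (1/2) 1 $ Suc n \<le> 0"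
proof (induction n)
  case 0
  show ?case by (simp add: binom_fps_def)
next
  case (Suc n)
  have h: "(1/2 :: real) gchoose Suc (Suc n) = (1/2 gchoose Suc n) * ((1/2 - real (Suc n)) / real (Suc (Suc n)))"
    using gbinomial_absorb_comp[of "1/2::real" "Suc n"] gbinomial_absorption[of "Suc n" "1/2::real"]
    by (simp add: field_simps)
  have "binom_fps (1/2) 1 $ Suc (Suc n)
      = binom_fps (1/2) 1 $ Suc n * ((real (Suc n) - 1/2) / real (Suc (Suc n)))"
    unfolding binom_fps_def fps_nth_Abs_fps h by (simp add: algebra_simps diff_divide_distrib)
  then show ?case using Suc by (simp only:) (intro mult_nonpos_nonneg, auto)
qed

text \<open>The series squares to \<open>1 - z\<close> and hence vanishes at 1; its constant term is
  1 and all others have one sign.\<close>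

lemma sqrt_coeff_tail_sum: "(\<lambda>n. \<bar>binom_fps (1/2) 1 $ Suc n\<bar>) sums 1"
proof -
  have s: "summable (\<lambda>n. binom_fps (1/2) 1 $ n)"
    using summable_binom_fps[of 1] by (auto intro: summable_rabs_cancel)
  have "(\<Sum>n. of_real (binom_fps (1/2) 1 $ n) * (1::complex) ^ n)\<^sup>2 = 0"
    using sqrt_series_square[of 1 1] by simp
  moreover have "(\<Sum>n. of_real (binom_fps (1/2) 1 $ n) * (1::complex) ^ n) = of_real (\<Sum>n. binom_fps (1/2) 1 $ n)"
    using suminf_of_real[OF s, where ?'a = complex] by simp
  ultimately have "(\<Sum>n. binom_fps (1/2) 1 $ n) = 0" by simp
  then have "(\<lambda>n. binom_fps (1/2) 1 $ n) sums 0" using summable_sums[OF s] by metis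
  then have "(\<lambda>n. binom_fps (1/2) 1 $ Suc n) sums (0 - 1)"
    using sums_Suc_iff[of "\<lambda>n. binom_fps (1/2) 1 $ n" "0 - 1"] by (simp add: binom_fps_def)
  then have "(\<lambda>n. - (binom_fps (1/2) 1 $ Suc n)) sums 1" using sums_minus by fastforce
  then show ?thesis using sqrt_coeff_nonpos by (simp add: abs_of_nonpos)
qed

text \<open>The tail is dominated by the coefficients of the case \<open>a = 1\<close>, so the sum
  lies in the disc of radius 1 around 1. This is the information that selects the branch of the
  root.\<close>

lemma sqrt_series_Re_nonneg:
  fixes z :: complex
  assumes a: "0 \<le> a" "a \<le> 1" and z: "norm z \<le> 1"
  shows "0 \<le> Re (\<Sum>n. of_real (binom_fps (1/2) a $ n) * z ^ n)"
proof -
  let ?f = "\<lambda>n. complex_of_real (binom_fps (1/2) a $ n) * z ^ n"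
  have s: "summable (\<lambda>n. norm (?f n))" by (rule summable_norm_fps_power[OF summable_binom_fps[OF a] z])
  have "norm (?f (Suc n)) \<le> \<bar>binom_fps (1/2) 1 $ Suc n\<bar>" for n
  proof -
    have "norm (?f (Suc n)) = \<bar>binom_fps (1/2) 1 $ Suc n\<bar> * (a * norm z) ^ Suc n"
      using a by (simp add: binom_fps_def norm_mult norm_power abs_mult power_mult_distrib)
    moreover have "(a * norm z) ^ Suc n \<le> 1" using a z by (intro power_le_one) (auto simp: mult_le_one)
    ultimately show ?thesis by (simp add: mult_left_le)
  qed
  then have "norm (\<Sum>n. ?f (Suc n)) \<le> (\<Sum>n. \<bar>binom_fps (1/2) 1 $ Suc n\<bar>)"
    using sqrt_coeff_tail_sum by (intro norm_suminf_le) (auto simp: sums_iff)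
  then have "norm (\<Sum>n. ?f (Suc n)) \<le> 1" using sqrt_coeff_tail_sum by (simp add: sums_iff)
  moreover have "(\<Sum>n. ?f n) = 1 + (\<Sum>n. ?f (Suc n))"
    using suminf_split_head[OF summable_norm_cancel[OF s]] by (simp add: binom_fps_def)
  ultimately show ?thesis using abs_Re_le_cmod[of "\<Sum>n. ?f (Suc n)"] by simp
qed

text \<open>The singularity at 1 comes from \<open>(1 - z)^(1/2)\<close> alone; the other factor
  enters through its value \<open>sqrt (1 - alpha)\<close>, where
  \<open>1 - alpha = 2 (sqrt 2 - 1)\<close>. The sign comes from
  \<open>Gamma (-1/2) = -2 sqrt pi\<close>.\<close>

lemma S_fps_asymp:
  "(\<lambda>n. S_fps $ n * real (n + 1) powr (3/2)) \<longlonglongrightarrow> - sqrt ((sqrt 2 - 1) / (2 * pi))"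
proof -
  have "(\<lambda>n. S_fps $ n * real (n + 1) powr (1/2 + 1)) \<longlonglongrightarrow> inverse (Gamma (-(1/2))) * (\<Sum>n. binom_fps (1/2) alpha $ n)"
    unfolding S_fps_def
    by (rule fps_mult_weighted_limit[OF _ binom_fps_asymp]) (use alpha_pos alpha_less_1 summable_binom_fps_weighted in auto)
  moreover have "Gamma (-(1/2) :: real) = - 2 * sqrt pi"
  proof -
    have "real_of_int n * 2 \<noteq> - 1" for n
    proof
      assume "real_of_int n * 2 = - 1"
      then have "n * 2 = - 1" by linarith
      then show False by presburger
    qed
    then have "-(1/2) \<notin> (\<int>\<^sub>\<le>\<^sub>0 :: real set)"
      by (auto simp: nonpos_Ints_def field_simps) (metis add.inverse_inverse)
    then show ?thesis
      using Gamma_plus1[of "-(1/2) :: real"] Gamma_one_half_real by simp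
  qed
  moreover have "(\<Sum>n. binom_fps (1/2) alpha $ n) = sqrt (1 - alpha)"
    using gen_binomial_real[of "- alpha" "1/2"] alpha_pos alpha_less_1
    by (simp add: binom_fps_def sums_iff powr_half_sqrt)
  moreover have "inverse (- 2 * sqrt pi) * sqrt (1 - alpha) = - sqrt ((sqrt 2 - 1) / (2 * pi))"
  proof -
    have "sqrt ((sqrt 2 - 1) / (2 * pi)) = sqrt ((1 - alpha) / (4 * pi))"
      by (simp add: alpha_eq field_simps)
    also have "\<dots> = sqrt (1 - alpha) / (2 * sqrt pi)" by (simp add: real_sqrt_divide real_sqrt_mult)
    finally have h: "sqrt ((sqrt 2 - 1) / (2 * pi)) = sqrt (1 - alpha) / (2 * sqrt pi)" .
    show ?thesis unfolding h by (simp only: divide_inverse inverse_minus_eq mult_minus_left mult_minus_right mult.commute)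
  qed
  ultimately show ?thesis by (simp add: add.commute)
qed

lemma summable_S_fps: "summable (\<lambda>n. \<bar>S_fps $ n\<bar>)"
  by (rule summable_of_weighted_limit[OF S_fps_asymp]) simp

lemma R_fps_tendsto_0: "(\<lambda>n. R_fps $ n) \<longlonglongrightarrow> 0"
proof -
  have "(\<lambda>n. R_fps $ n * real (n + 1) powr (-1/2 + 1)) \<longlonglongrightarrow> inverse (Gamma (- (-1/2))) * (\<Sum>n. binom_fps (-1/2) alpha $ n)"
    unfolding R_fps_def
    by (rule fps_mult_weighted_limit[OF _ binom_fps_asymp]) (use alpha_pos alpha_less_1 summable_binom_fps_weighted in auto)
  moreover have "(\<lambda>n. real (n + 1) powr (-1/2)) \<longlonglongrightarrow> 0" by real_asymp
  ultimately have "(\<lambda>n. (R_fps $ n * real (n + 1) powr (-1/2 + 1)) * real (n + 1) powr (-1/2)) \<longlonglongrightarrow> 0"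
    using tendsto_mult by fastforce
  then show ?thesis by (simp add: mult.assoc flip: powr_add)
qed

text \<open>The square of the sum is immediate; the branch is the point. \<open>p\<close> and
  \<open>q\<close> have nonnegative real parts and so do their squares, which puts both in the
  sector of arguments at most \<open>pi/4\<close>, with \<open>q\<close> strictly inside. Their
  product then has positive real part unless \<open>p = 0\<close>.\<close>

lemma S_fps_sums_csqrt:
  fixes z :: complex
  assumes z: "norm z \<le> 1"
  shows "(\<lambda>n. of_real (S_fps $ n) * z ^ n) sums csqrt ((1 - z) * (1 - z * of_real alpha))"
proof -
  define p where "p = (\<Sum>n. of_real (binom_fps (1/2) 1 $ n) * z ^ n)"
  define q where "q = (\<Sum>n. of_real (binom_fps (1/2) alpha $ n) * z ^ n)"
  have al: "0 \<le> alpha" "alpha \<le> 1" using alpha_pos alpha_less_1 by auto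
  have p2: "p\<^sup>2 = 1 - z" and q2: "q\<^sup>2 = 1 - z * of_real alpha"
    using sqrt_series_square[of 1 z] sqrt_series_square[OF al z] z by (simp_all add: p_def q_def mult.commute)
  have pr: "0 \<le> Re p" and qr: "0 \<le> Re q"
    using sqrt_series_Re_nonneg[of 1 z] sqrt_series_Re_nonneg[OF al z] z by (simp_all add: p_def q_def)
  have "Re z \<le> 1" using z complex_Re_le_cmod[of z] by linarith
  then have "Re z * alpha \<le> 1 * alpha" using alpha_pos by (intro mult_right_mono) auto
  then have "Re z * alpha < 1" using alpha_less_1 by linarith
  then have "0 < Re (q\<^sup>2)" "0 \<le> Re (p\<^sup>2)" using \<open>Re z \<le> 1\<close> unfolding p2 q2 by simp_all
  then have "(Im q)\<^sup>2 < (Re q)\<^sup>2" "(Im p)\<^sup>2 \<le> (Re p)\<^sup>2" by (simp_all add: power2_eq_square)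
  then have im: "\<bar>Im q\<bar> < Re q" "\<bar>Im p\<bar> \<le> Re p"
    using pr qr power2_less_imp_less[of "\<bar>Im q\<bar>" "Re q"] power2_le_imp_le[of "\<bar>Im p\<bar>" "Re p"] by simp_all
  have "0 < Re (p * q) \<or> Re (p * q) = 0 \<and> 0 \<le> Im (p * q)"
  proof (cases "Re p = 0")
    case True
    then have "p = 0" using im by (auto simp: complex_eq_iff)
    then show ?thesis by simp
  next
    case False
    have "Im p * Im q \<le> \<bar>Im p\<bar> * \<bar>Im q\<bar>" by (metis abs_ge_self abs_mult)
    also have "\<dots> \<le> Re p * \<bar>Im q\<bar>" using im by (intro mult_right_mono) auto
    also have "\<dots> < Re p * Re q" using im pr False by (intro mult_strict_left_mono) auto
    finally show ?thesis by simp
  qed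
  moreover have "(p * q)\<^sup>2 = (1 - z) * (1 - z * of_real alpha)" by (simp add: power_mult_distrib p2 q2)
  ultimately have "csqrt ((1 - z) * (1 - z * of_real alpha)) = p * q" by (intro csqrt_unique)
  then show ?thesis
    unfolding S_fps_def p_def q_def
    using sums_fps_mult[OF summable_binom_fps[of 1] summable_binom_fps[OF al] z] by simp
qed

definition S_fun :: "real \<Rightarrow> real" where
  "S_fun x = sqrt ((1 - x) * (1 - alpha * x))"

lemma S_fps_sums:
  assumes "0 \<le> x" "x \<le> 1"
  shows "(\<lambda>n. S_fps $ n * x ^ n) sums S_fun x"
proof -
  have "alpha * x \<le> 1" using assms alpha_pos alpha_less_1 by (simp add: mult_le_one)
  then have "0 \<le> (1 - x) * (1 - alpha * x)" using assms by simp
  then have "csqrt ((1 - of_real x) * (1 - of_real x * of_real alpha)) = of_real (S_fun x)"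
    using of_real_sqrt[of "(1 - x) * (1 - alpha * x)"] by (simp add: S_fun_def mult.commute)
  then have "(\<lambda>n. complex_of_real (S_fps $ n * x ^ n)) sums of_real (S_fun x)"
    using S_fps_sums_csqrt[of "of_real x"] assms by simp
  then show ?thesis by (simp only: sums_of_real_iff)
qed

lemma S_fun_pos:
  assumes "0 \<le> x" "x < 1"
  shows "0 < S_fun x"
proof -
  have "alpha * x \<le> alpha" using assms alpha_pos by (simp add: mult_left_le)
  then show ?thesis using assms alpha_less_1 by (simp add: S_fun_def)
qed

lemma R_fps_bounded: obtains C where "\<And>n. \<bar>R_fps $ n\<bar> \<le> C"
  using convergent_imp_Bseq[OF convergentI[OF R_fps_tendsto_0]] unfolding Bseq_def by auto

lemma R_fps_sums:
  assumes "0 \<le> x" "x < 1"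
  shows "(\<lambda>n. R_fps $ n * x ^ n) sums inverse (S_fun x)"
proof -
  obtain C where C: "\<And>n. \<bar>R_fps $ n\<bar> \<le> C" using R_fps_bounded by blast
  have R: "summable (\<lambda>n. norm (R_fps $ n * x ^ n))"
  proof (rule summable_comparison_test'[where N = 0])
    show "summable (\<lambda>n. C * x ^ n)" using assms by (intro summable_mult summable_geometric) auto
    show "norm (norm (R_fps $ n * x ^ n)) \<le> C * x ^ n" for n
      using C[of n] assms by (simp add: abs_mult mult_right_mono)
  qed
  have S: "summable (\<lambda>n. norm (S_fps $ n * x ^ n))"
    using summable_norm_fps_power[OF summable_S_fps, of x] assms by simp
  have "(\<Sum>i\<le>n. S_fps $ i * x ^ i * (R_fps $ (n - i) * x ^ (n - i))) = (S_fps * R_fps) $ n * x ^ n" for n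
  proof -
    have "S_fps $ i * x ^ i * (R_fps $ (n - i) * x ^ (n - i)) = S_fps $ i * R_fps $ (n - i) * x ^ n" if "i \<le> n" for i
    proof -
      have "x ^ n = x ^ i * x ^ (n - i)" using that by (simp flip: power_add)
      then show ?thesis by simp
    qed
    then show ?thesis unfolding fps_mult_nth sum_distrib_right atLeast0AtMost by (intro sum.cong) auto
  qed
  then have "(\<lambda>n. (S_fps * R_fps) $ n * x ^ n) sums (S_fun x * (\<Sum>n. R_fps $ n * x ^ n))"
    using Cauchy_product_sums[OF S R] S_fps_sums[of x] assms by (simp add: sums_iff)
  moreover have "(\<lambda>n. (S_fps * R_fps) $ n * x ^ n) sums 1"
    using sums_fps_linear[of 0 x] by (simp add: S_fps_times_R_fps)
  ultimately have "S_fun x * (\<Sum>n. R_fps $ n * x ^ n) = 1" using sums_unique2 by blast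
  then have "(\<Sum>n. R_fps $ n * x ^ n) = inverse (S_fun x)" by (metis inverse_unique)
  then show ?thesis using summable_norm_cancel[OF R] by (simp add: sums_iff)
qed


section \<open>Bounded harmonic functions in a half-plane\<close>

text \<open>The probability that the walk started at \<open>(0, j)\<close> reaches height 0 within \<open>n\<close> steps, and does so at \<open>(k, 0)\<close>.\<close>

fun half_plane_hit :: "nat \<Rightarrow> nat \<Rightarrow> int \<Rightarrow> real" where
  "half_plane_hit n 0 k = (if k = 0 then 1 else 0)"
| "half_plane_hit 0 (Suc j) k = 0"
| "half_plane_hit (Suc n) (Suc j) k =
     (half_plane_hit n (Suc j) (k + 1) + half_plane_hit n (Suc j) (k - 1) + half_plane_hit n (Suc (Suc j)) k + half_plane_hit n j k) / 4"

lemma half_plane_hit_nonneg: "0 \<le> half_plane_hit n j k"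
  by (induction n j k rule: half_plane_hit.induct) auto

lemma half_plane_hit_mono: "half_plane_hit n j k \<le> half_plane_hit (Suc n) j k"
proof (induction n j k rule: half_plane_hit.induct)
  case (3 n j k)
  show ?case
    unfolding half_plane_hit.simps(3)[of n j k] half_plane_hit.simps(3)[of "Suc n" j k]
    by (intro divide_right_mono add_mono 3) simp_all
qed (auto simp: half_plane_hit_nonneg)

lemma half_plane_hit_sym: "half_plane_hit n j (- k) = half_plane_hit n j k"
proof (induction n j k rule: half_plane_hit.induct)
  case (3 n j k)
  have "- k + 1 = - (k - 1)" "- k - 1 = - (k + 1)" by auto
  then show ?case using 3 by simp
qed auto

lemma half_plane_hit_sum_le_1: "finite A \<Longrightarrow> (\<Sum>k\<in>A. half_plane_hit n j k) \<le> 1"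
proof (induction n arbitrary: j A)
  case 0
  have "card (A \<inter> {0}) \<le> card {0::int}" by (intro card_mono) auto
  then show ?case using 0 by (cases j) (auto simp: sum.If_cases)
next
  case (Suc n)
  show ?case
  proof (cases j)
    case 0
    have "card (A \<inter> {0}) \<le> card {0::int}" by (intro card_mono) auto
    then show ?thesis using 0 Suc.prems by (auto simp: sum.If_cases)
  next
    case (Suc i)
    have shift: "(\<Sum>k\<in>A. half_plane_hit n (Suc i) (k + d)) = (\<Sum>k\<in>(\<lambda>k. k + d) ` A. half_plane_hit n (Suc i) k)" for d
      by (subst sum.reindex) (auto simp: inj_on_def)
    have "(\<Sum>k\<in>A. half_plane_hit (Suc n) (Suc i) k) = ((\<Sum>k\<in>A. half_plane_hit n (Suc i) (k + 1)) + (\<Sum>k\<in>A. half_plane_hit n (Suc i) (k + (-1)))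
       + (\<Sum>k\<in>A. half_plane_hit n (Suc (Suc i)) k) + (\<Sum>k\<in>A. half_plane_hit n i k)) / 4"
      by (simp only: half_plane_hit.simps sum.distrib sum_divide_distrib[symmetric] diff_conv_add_uminus)
    also have "\<dots> \<le> (1 + 1 + 1 + 1) / 4"
      unfolding shift using Suc.IH Suc.prems by (intro divide_right_mono add_mono) auto
    finally show ?thesis using Suc by simp
  qed
qed

section \<open>Discrete Poisson kernel and harmonic extension\<close>

definition poisson_kernel :: "nat \<Rightarrow> int \<Rightarrow> real" where
  "poisson_kernel j k = lim (\<lambda>n. half_plane_hit n j k)"

lemma poisson_kernel_LIMSEQ: "(\<lambda>n. half_plane_hit n j k) \<longlonglongrightarrow> poisson_kernel j k"
proof -
  have "incseq (\<lambda>n. half_plane_hit n j k)" by (rule incseq_SucI) (rule half_plane_hit_mono)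
  moreover have "half_plane_hit n j k \<le> 1" for n using half_plane_hit_sum_le_1[of "{k}" n j] by simp
  ultimately obtain L where "(\<lambda>n. half_plane_hit n j k) \<longlonglongrightarrow> L"
    using incseq_convergent[of "\<lambda>n. half_plane_hit n j k" 1] by blast
  then have "convergent (\<lambda>n. half_plane_hit n j k)" by (rule convergentI)
  then show ?thesis by (simp add: poisson_kernel_def convergent_LIMSEQ_iff)
qed

lemma poisson_kernel_0: "poisson_kernel 0 k = (if k = 0 then 1 else 0)"
  by (simp add: poisson_kernel_def)

lemma poisson_kernel_nonneg: "0 \<le> poisson_kernel j k"
  by (rule LIMSEQ_le_const[OF poisson_kernel_LIMSEQ]) (auto simp: half_plane_hit_nonneg)

lemma poisson_kernel_sym: "poisson_kernel j (- k) = poisson_kernel j k"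
  by (simp add: poisson_kernel_def half_plane_hit_sym)

text \<open>Mass at most 1 is what the limit of partial sums gives directly; mass exactly 1 at
  height 1 is recovered in \<open>poisson_const\<close> from uniqueness.\<close>

lemma poisson_kernel_sum_le_1: "finite A \<Longrightarrow> (\<Sum>k\<in>A. poisson_kernel j k) \<le> 1"
  using LIMSEQ_le_const2[of "\<lambda>n. \<Sum>k\<in>A. half_plane_hit n j k" "\<Sum>k\<in>A. poisson_kernel j k" 1]
    tendsto_sum[of A "\<lambda>k n. half_plane_hit n j k" "poisson_kernel j" sequentially] poisson_kernel_LIMSEQ half_plane_hit_sum_le_1 by blast

lemma poisson_kernel_harmonic: "4 * poisson_kernel (Suc j) k = poisson_kernel (Suc j) (k + 1) + poisson_kernel (Suc j) (k - 1) + poisson_kernel (Suc (Suc j)) k + poisson_kernel j k"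
proof -
  have eq: "4 * half_plane_hit (Suc n) (Suc j) k = half_plane_hit n (Suc j) (k + 1) + half_plane_hit n (Suc j) (k - 1) + half_plane_hit n (Suc (Suc j)) k + half_plane_hit n j k" for n
    unfolding half_plane_hit.simps(3) times_divide_eq_right by (rule nonzero_mult_div_cancel_left) simp
  have "(\<lambda>n. 4 * half_plane_hit (Suc n) (Suc j) k) \<longlonglongrightarrow> poisson_kernel (Suc j) (k + 1) + poisson_kernel (Suc j) (k - 1) + poisson_kernel (Suc (Suc j)) k + poisson_kernel j k"
    unfolding eq by (intro tendsto_intros poisson_kernel_LIMSEQ)
  moreover have "(\<lambda>n. 4 * half_plane_hit (Suc n) (Suc j) k) \<longlonglongrightarrow> 4 * poisson_kernel (Suc j) k"
    by (rule tendsto_mult_left[OF LIMSEQ_Suc[OF poisson_kernel_LIMSEQ]])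
  ultimately show ?thesis by (rule LIMSEQ_unique[rotated])
qed

lemma poisson_kernel_summable: "poisson_kernel j summable_on UNIV"
  by (rule nonneg_bdd_above_summable_on) (auto simp: poisson_kernel_nonneg intro!: bdd_aboveI[of _ 1] poisson_kernel_sum_le_1)

lemma poisson_kernel_infsum_le_1: "infsum (poisson_kernel j) UNIV \<le> 1"
  by (rule infsum_le_finite_sums[OF poisson_kernel_summable]) (auto simp: poisson_kernel_sum_le_1)

lemma summable_on_mult_bounded:
  fixes f g :: "'a \<Rightarrow> real"
  assumes "f summable_on A" "\<And>x. x \<in> A \<Longrightarrow> \<bar>g x\<bar> \<le> M"
  shows "(\<lambda>x. f x * g x) summable_on A"
proof -
  have "(\<lambda>x. \<bar>f x\<bar>) summable_on A"
    using assms(1) summable_on_iff_abs_summable_on_real[of f A] by simp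
  then have "(\<lambda>x. \<bar>f x\<bar> * M) summable_on A" by (rule summable_on_cmult_left)
  then have "(\<lambda>x. norm (f x * g x)) summable_on A"
  proof (rule summable_on_comparison_test)
    show "norm (f x * g x) \<le> \<bar>f x\<bar> * M" if "x \<in> A" for x
      unfolding real_norm_def abs_mult using assms(2)[OF that] by (rule mult_left_mono) simp
  qed simp
  then show ?thesis by (rule abs_summable_summable)
qed

lemma summable_on_shift_int:
  fixes f :: "int \<Rightarrow> real"
  assumes "f summable_on UNIV"
  shows "(\<lambda>k. f (k + d)) summable_on UNIV"
  using summable_on_reindex_bij_betw[of "\<lambda>k. k + d" UNIV UNIV f] assms
  by (simp add: bij_plus_right o_def)

lemma infsum_shift_int: "infsum (\<lambda>k. f (k + d)) UNIV = infsum f (UNIV :: int set)"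
  using infsum_reindex_bij_betw[of "\<lambda>k. k + d" UNIV UNIV f] by (simp add: bij_plus_right)

text \<open>The bounded harmonic extension of axis data \<open>v\<close> to the upper half-plane, at
  the point \<open>(m, j)\<close>; \<open>half_plane_poisson\<close> shows that there is no other
  one.\<close>

definition poisson :: "nat \<Rightarrow> (int \<Rightarrow> real) \<Rightarrow> int \<Rightarrow> real" where
  "poisson j v m = (\<Sum>\<^sub>\<infinity>k. poisson_kernel j k * v (m - k))"

lemma poisson_0: "poisson 0 v m = v m"
proof -
  have "poisson 0 v m = (\<Sum>\<^sub>\<infinity>k\<in>{0}. poisson_kernel 0 k * v (m - k))"
    unfolding poisson_def by (rule infsum_cong_neutral) (auto simp: poisson_kernel_0)
  then show ?thesis by (simp add: poisson_kernel_0)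
qed

context
  fixes v :: "int \<Rightarrow> real" and M :: real
  assumes v: "\<And>m. \<bar>v m\<bar> \<le> M"
begin

lemma poisson_summable: "(\<lambda>k. poisson_kernel j k * v (m - k)) summable_on UNIV"
  by (rule summable_on_mult_bounded[OF poisson_kernel_summable]) (rule v)

lemma poisson_bound: "\<bar>poisson j v m\<bar> \<le> M"
proof -
  have M: "0 \<le> M" using v[of 0] by linarith
  have s: "(\<lambda>k. poisson_kernel j k * M) summable_on UNIV" by (rule summable_on_cmult_left[OF poisson_kernel_summable])
  have le: "poisson_kernel j k * v (m - k) \<le> poisson_kernel j k * M" "- (poisson_kernel j k * M) \<le> poisson_kernel j k * v (m - k)" for k
    using v[of "m - k"] poisson_kernel_nonneg[of j k] mult_left_mono[of "v (m - k)" M "poisson_kernel j k"]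
      mult_left_mono[of "- M" "v (m - k)" "poisson_kernel j k"] by (auto simp: abs_le_iff)
  have "infsum (\<lambda>k. poisson_kernel j k * M) UNIV \<le> M"
    using poisson_kernel_infsum_le_1[of j] M poisson_kernel_summable[of j] by (simp add: infsum_cmult_left mult_left_le_one_le infsum_nonneg poisson_kernel_nonneg)
  moreover have "poisson j v m \<le> infsum (\<lambda>k. poisson_kernel j k * M) UNIV"
    unfolding poisson_def by (rule infsum_mono[OF poisson_summable s]) (rule le)
  moreover have "infsum (\<lambda>k. - (poisson_kernel j k * M)) UNIV \<le> poisson j v m"
    unfolding poisson_def by (rule infsum_mono[OF _ poisson_summable]) (auto simp: le summable_on_uminus s)
  ultimately show ?thesis by (simp add: infsum_uminus abs_le_iff)
qed

lemma poisson_shift: "(\<lambda>k. poisson_kernel j (k + d) * v (m - k)) summable_on UNIV"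
   "infsum (\<lambda>k. poisson_kernel j (k + d) * v (m - k)) UNIV = poisson j v (m + d)"
proof -
  have eq: "(\<lambda>k. poisson_kernel j (k + d) * v (m - k)) = (\<lambda>k. (\<lambda>l. poisson_kernel j l * v (m + d - l)) (k + d))"
    by (rule ext) simp
  show "(\<lambda>k. poisson_kernel j (k + d) * v (m - k)) summable_on UNIV"
    unfolding eq by (rule summable_on_shift_int) (rule poisson_summable)
  show "infsum (\<lambda>k. poisson_kernel j (k + d) * v (m - k)) UNIV = poisson j v (m + d)"
    unfolding eq by (subst infsum_shift_int) (simp add: poisson_def)
qed

lemma poisson_harmonic:
  "4 * poisson (Suc j) v m = poisson (Suc j) v (m + 1) + poisson (Suc j) v (m - 1)
     + poisson (Suc (Suc j)) v m + poisson j v m"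
proof -
  have "((\<lambda>k. poisson_kernel (Suc j) (k + 1) * v (m - k) + poisson_kernel (Suc j) (k + (-1)) * v (m - k)
       + poisson_kernel (Suc (Suc j)) k * v (m - k) + poisson_kernel j k * v (m - k)) has_sum
     (poisson (Suc j) v (m + 1) + poisson (Suc j) v (m + (-1)) + poisson (Suc (Suc j)) v m + poisson j v m)) UNIV"
    by (intro has_sum_add has_sum_infsum[OF poisson_shift(1), unfolded poisson_shift(2)]
        has_sum_infsum[OF poisson_summable, folded poisson_def])
  also have "(\<lambda>k. poisson_kernel (Suc j) (k + 1) * v (m - k) + poisson_kernel (Suc j) (k + (-1)) * v (m - k)
       + poisson_kernel (Suc (Suc j)) k * v (m - k) + poisson_kernel j k * v (m - k)) = (\<lambda>k. 4 * (poisson_kernel (Suc j) k * v (m - k)))"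
  proof
    fix k
    have "4 * (poisson_kernel (Suc j) k * v (m - k)) = (4 * poisson_kernel (Suc j) k) * v (m - k)" by simp
    then show "poisson_kernel (Suc j) (k + 1) * v (m - k) + poisson_kernel (Suc j) (k + (-1)) * v (m - k)
       + poisson_kernel (Suc (Suc j)) k * v (m - k) + poisson_kernel j k * v (m - k) = 4 * (poisson_kernel (Suc j) k * v (m - k))"
      unfolding poisson_kernel_harmonic by (simp only: distrib_right diff_conv_add_uminus)
  qed
  finally have *: "((\<lambda>k. 4 * (poisson_kernel (Suc j) k * v (m - k))) has_sum
     (poisson (Suc j) v (m + 1) + poisson (Suc j) v (m + (-1)) + poisson (Suc (Suc j)) v m + poisson j v m)) UNIV" .
  have "((\<lambda>k. 4 * (poisson_kernel (Suc j) k * v (m - k))) has_sum 4 * poisson (Suc j) v m) UNIV"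
    by (intro has_sum_cmult_right has_sum_infsum[OF poisson_summable, folded poisson_def])
  from has_sum_unique[OF this *] show ?thesis by simp
qed

end

text \<open>The supremum over each horizontal line is a convex function of the height.\<close>

lemma half_plane_unique:
  fixes v :: "int \<Rightarrow> nat \<Rightarrow> real"
  assumes bound: "\<And>m j. \<bar>v m j\<bar> \<le> M"
    and zero: "\<And>m. v m 0 = 0"
    and harm: "\<And>m j. 4 * v m (Suc j) = v (m + 1) (Suc j) + v (m - 1) (Suc j) + v m (Suc (Suc j)) + v m j"
  shows "v m j = 0"
proof -
  define V where "V j = (SUP m. \<bar>v m j\<bar>)" for j
  have bdd: "bdd_above (range (\<lambda>m. \<bar>v m j\<bar>))" for j by (rule bdd_aboveI[of _ M]) (auto simp: bound)
  have up: "\<bar>v m j\<bar> \<le> V j" for m j unfolding V_def by (rule cSUP_upper[OF _ bdd]) simp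
  have VM: "V j \<le> M" for j unfolding V_def by (rule cSUP_least) (auto simp: bound)
  have V0: "V 0 = 0" by (simp add: V_def zero)
  \<comment> \<open>Two of the four neighbours lie in the same row, so \<open>2 * V (Suc j)\<close>
    cancels.\<close>
  have convex: "2 * V (Suc j) \<le> V (Suc (Suc j)) + V j" for j
  proof -
    have *: "4 * \<bar>v m (Suc j)\<bar> \<le> 2 * V (Suc j) + V (Suc (Suc j)) + V j" for m
      using harm[of m j] up[of "m + 1" "Suc j"] up[of "m - 1" "Suc j"] up[of m "Suc (Suc j)"] up[of m j] by linarith
    have "\<bar>v m (Suc j)\<bar> \<le> (2 * V (Suc j) + V (Suc (Suc j)) + V j) / 4" for m
      using *[of m] by (simp add: field_simps)
    then have "V (Suc j) \<le> (2 * V (Suc j) + V (Suc (Suc j)) + V j) / 4"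
      unfolding V_def[of "Suc j"] by (intro cSUP_least) auto
    then show ?thesis by (simp add: field_simps)
  qed
  \<comment> \<open>A bounded convex sequence cannot increase: a positive slope \<open>d\<close>
    would persist and carry \<open>V\<close> linearly above \<open>M\<close>.\<close>
  have dec: "V (Suc j) \<le> V j" for j
  proof (rule ccontr)
    assume "\<not> V (Suc j) \<le> V j"
    define d where "d = V (Suc j) - V j"
    have "d > 0" using \<open>\<not> V (Suc j) \<le> V j\<close> by (simp add: d_def)
    have inc: "d \<le> V (Suc (j + i)) - V (j + i)" for i
    proof (induction i)
      case (Suc i)
      then show ?case using convex[of "j + i"] by simp
    qed (simp add: d_def)
    have ge: "real i * d \<le> V (j + i) - V j" for i
    proof (induction i)
      case (Suc i)
      then show ?case using inc[of i] by (simp add: algebra_simps)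
    qed simp
    obtain i where "M - V j < real i * d" using \<open>d > 0\<close> reals_Archimedean3 by blast
    then show False using VM[of "j + i"] ge[of i] by linarith
  qed
  have "V j \<le> 0"
  proof (induction j)
    case 0
    show ?case by (simp add: V0)
  next
    case (Suc j)
    show ?case by (rule order_trans[OF dec Suc])
  qed
  then have "\<bar>v m j\<bar> \<le> 0" by (rule order_trans[OF up])
  then show ?thesis by simp
qed

text \<open>The extension of the axis values shares their boundary row and the recursion, so
  \<open>half_plane_unique\<close> kills the difference. It is applied to the cosine solutions, to
  the constant 1 and to the generating functions.\<close>

lemma half_plane_poisson:
  fixes F :: "int \<Rightarrow> nat \<Rightarrow> real"
  assumes bound: "\<And>m j. \<bar>F m j\<bar> \<le> M"
    and harm: "\<And>m j. 4 * F m (Suc j) = F (m + 1) (Suc j) + F (m - 1) (Suc j) + F m (Suc (Suc j)) + F m j"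
  shows "F m j = poisson j (\<lambda>m. F m 0) m"
proof -
  have b: "\<bar>F m 0\<bar> \<le> M" for m by (rule bound)
  have "F m j - poisson j (\<lambda>m. F m 0) m = 0"
  proof (rule half_plane_unique[where M = "M + M" and v = "\<lambda>m j. F m j - poisson j (\<lambda>m. F m 0) m"])
    show "\<bar>F m j - poisson j (\<lambda>m. F m 0) m\<bar> \<le> M + M" for m j
      using bound[of m j] poisson_bound[of "\<lambda>m. F m 0" M j m, OF b] by linarith
    show "F m 0 - poisson 0 (\<lambda>m. F m 0) m = 0" for m by (simp add: poisson_0)
    show "4 * (F m (Suc j) - poisson (Suc j) (\<lambda>m. F m 0) m) =
       F (m + 1) (Suc j) - poisson (Suc j) (\<lambda>m. F m 0) (m + 1) +
       (F (m - 1) (Suc j) - poisson (Suc j) (\<lambda>m. F m 0) (m - 1)) +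
       (F m (Suc (Suc j)) - poisson (Suc (Suc j)) (\<lambda>m. F m 0) m) +
       (F m j - poisson j (\<lambda>m. F m 0) m)" for m j
      unfolding right_diff_distrib harm[of m j] poisson_harmonic[of "\<lambda>m. F m 0" M j m, OF b] by linarith
  qed
  then show ?thesis by simp
qed


section \<open>Wiener--Hopf factorisation on the axis\<close>

lemma summable_on_abs_real:
  fixes f :: "'a \<Rightarrow> real"
  assumes "f summable_on A"
  shows "(\<lambda>x. \<bar>f x\<bar>) summable_on A"
  using assms summable_on_iff_abs_summable_on_real[of f A] by simp

lemma summable_on_product_real:
  fixes f :: "'a \<Rightarrow> real" and g :: "'b \<Rightarrow> real"
  assumes f: "f summable_on A" and g: "g summable_on B"
  shows "(\<lambda>(x, y). f x * g y) summable_on A \<times> B"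
proof -
  have "(\<lambda>p. norm (case p of (x, y) \<Rightarrow> f x * g y)) summable_on A \<times> B"
  proof (subst Infinite_Sum.abs_summable_on_Sigma_iff, intro conjI ballI)
    show "(\<lambda>y. norm (case (x, y) of (x, y) \<Rightarrow> f x * g y)) summable_on B" for x
      using summable_on_cmult_right[OF summable_on_abs_real[OF g], of "\<bar>f x\<bar>"] by (simp add: abs_mult)
    have "(\<lambda>x. \<Sum>\<^sub>\<infinity>y\<in>B. norm (case (x, y) of (x, y) \<Rightarrow> f x * g y)) = (\<lambda>x. \<bar>f x\<bar> * (\<Sum>\<^sub>\<infinity>y\<in>B. \<bar>g y\<bar>))"
      by (simp add: abs_mult infsum_cmult_right')
    then show "(\<lambda>x. norm (\<Sum>\<^sub>\<infinity>y\<in>B. norm (case (x, y) of (x, y) \<Rightarrow> f x * g y))) summable_on A"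
      using summable_on_cmult_left[OF summable_on_abs_real[OF f], of "\<Sum>\<^sub>\<infinity>y\<in>B. \<bar>g y\<bar>"]
      by (simp add: abs_mult infsum_nonneg)
  qed
  then show ?thesis by (rule abs_summable_summable)
qed

text \<open>Fubini after the substitution \<open>j = i + k\<close>. Only the two kernels are
  summable; \<open>v\<close> is merely bounded, as the function on the axis will be.\<close>

lemma
  fixes f g v :: "int \<Rightarrow> real"
  assumes f: "f summable_on UNIV" and g: "g summable_on UNIV" and v: "\<And>k. \<bar>v k\<bar> \<le> M"
  shows infsum_correlation:
    "(\<Sum>\<^sub>\<infinity>k. (\<Sum>\<^sub>\<infinity>i. f i * g (i + k)) * v k) = (\<Sum>\<^sub>\<infinity>i. f i * (\<Sum>\<^sub>\<infinity>j. g j * v (j - i)))"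
    and summable_correlation: "(\<lambda>k. \<Sum>\<^sub>\<infinity>i. f i * g (i + k)) summable_on UNIV"
proof -
  have "(\<lambda>(k, i). f i * g (i + k)) summable_on UNIV \<times> UNIV \<longleftrightarrow> (\<lambda>(i, j). f i * g j) summable_on UNIV \<times> UNIV"
    by (rule summable_on_reindex_bij_witness[of _ "\<lambda>(i, j). (j - i, i)" "\<lambda>(k, i). (i, i + k)"]) auto
  then have s: "(\<lambda>(k, i). f i * g (i + k)) summable_on UNIV \<times> UNIV"
    using summable_on_product_real[OF f g] by simp
  then show "(\<lambda>k. \<Sum>\<^sub>\<infinity>i. f i * g (i + k)) summable_on UNIV" by (rule summable_on_Sigma_banach)
  have "(\<lambda>p. (case p of (k, i) \<Rightarrow> f i * g (i + k)) * (case p of (k, i) \<Rightarrow> v k)) summable_on UNIV \<times> UNIV"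
    by (rule summable_on_mult_bounded[OF s, where M = M]) (auto simp: v)
  then have s': "(\<lambda>(k, i). f i * g (i + k) * v k) summable_on UNIV \<times> UNIV"
    by (simp add: case_prod_unfold)
  have "(\<Sum>\<^sub>\<infinity>k. (\<Sum>\<^sub>\<infinity>i. f i * g (i + k)) * v k) = (\<Sum>\<^sub>\<infinity>k. \<Sum>\<^sub>\<infinity>i. f i * g (i + k) * v k)"
    by (simp add: infsum_cmult_left')
  also have "\<dots> = (\<Sum>\<^sub>\<infinity>i. \<Sum>\<^sub>\<infinity>k. f i * g (i + k) * v k)" by (rule infsum_swap_banach[OF s'])
  also have "\<dots> = (\<Sum>\<^sub>\<infinity>i. f i * (\<Sum>\<^sub>\<infinity>k. g (i + k) * v k))" by (simp add: mult.assoc infsum_cmult_right')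
  also have "\<dots> = (\<Sum>\<^sub>\<infinity>i. f i * (\<Sum>\<^sub>\<infinity>j. g j * v (j - i)))"
  proof -
    have "(\<Sum>\<^sub>\<infinity>k. g (i + k) * v k) = (\<Sum>\<^sub>\<infinity>j. g j * v (j - i))" for i
      using infsum_shift_int[of "\<lambda>j. g j * v (j - i)" i] by (simp add: add.commute)
    then show ?thesis by simp
  qed
  finally show "(\<Sum>\<^sub>\<infinity>k. (\<Sum>\<^sub>\<infinity>i. f i * g (i + k)) * v k) = (\<Sum>\<^sub>\<infinity>i. f i * (\<Sum>\<^sub>\<infinity>j. g j * v (j - i)))" .
qed

section \<open>Uniqueness of cosine series\<close>

lemma has_integral_cos_int:
  "((\<lambda>t. cos (of_int m * t)) has_integral (if m = 0 then 2 * pi else 0)) {-pi..pi}"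
proof (cases "m = 0")
  case True
  then show ?thesis using has_integral_const_real[of "1::real" "-pi" pi] by simp
next
  case False
  have "((\<lambda>t. cos (of_int m * t)) has_integral
      (sin (of_int m * pi) / of_int m - sin (of_int m * (-pi)) / of_int m)) {-pi..pi}"
  proof (rule fundamental_theorem_of_calculus)
    fix x :: real
    show "((\<lambda>t. sin (of_int m * t) / of_int m) has_vector_derivative cos (of_int m * x)) (at x within {-pi..pi})"
      unfolding has_real_derivative_iff_has_vector_derivative[symmetric]
      using False by (auto intro!: derivative_eq_intros)
  qed simp
  then show ?thesis using False sin_npi_int[of m] by (simp add: mult.commute)
qed

lemma has_integral_cos_cos_int:
  "((\<lambda>t. cos (of_int k * t) * cos (of_int n * t)) has_integral
     (if k = n then pi else 0) + (if k = - n then pi else 0)) {-pi..pi}"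
proof -
  have "((\<lambda>t. (cos (of_int (k - n) * t) + cos (of_int (k + n) * t)) / 2) has_integral
     ((if k - n = 0 then 2 * pi else 0) + (if k + n = 0 then 2 * pi else 0)) / 2) {-pi..pi}"
    by (intro has_integral_divide has_integral_add has_integral_cos_int)
  moreover have "((if k - n = 0 then 2 * pi else 0) + (if k + n = 0 then 2 * pi else 0)) / 2
     = (if k = n then pi else 0) + (if k = - n then pi else 0)"
    by (auto simp: eq_neg_iff_add_eq_0)
  moreover have "(cos (of_int (k - n) * t) + cos (of_int (k + n) * t)) / 2 = cos (of_int k * t) * cos (of_int n * t)" for t :: real
    by (simp only: cos_times_cos of_int_add of_int_diff left_diff_distrib distrib_right)
  ultimately show ?thesis by (simp only:)
qed

text \<open>Uniform convergence allows termwise integration against \<open>cos (n t)\<close>; only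
  the indices \<open>n\<close> and \<open>- n\<close> survive, and symmetry makes their coefficients
  equal.\<close>

lemma cos_series_unique:
  fixes f :: "int \<Rightarrow> real"
  assumes f: "f summable_on UNIV" and sym: "\<And>k. f (- k) = f k"
    and zero: "\<And>t. (\<Sum>\<^sub>\<infinity>k. f k * cos (of_int k * t)) = 0"
  shows "f n = 0"
proof -
  define h where "h k t = f k * (cos (of_int k * t) * cos (of_int n * t))" for k t
  have "uniform_limit {-pi..pi} (\<lambda>X t. \<Sum>k\<in>X. h k t) (\<lambda>t. \<Sum>\<^sub>\<infinity>k. h k t) (finite_subsets_at_top UNIV)"
  proof (rule Weierstrass_m_test_general[OF _ summable_on_abs_real[OF f]])
    fix k :: int and t :: real
    have "\<bar>cos (of_int k * t)\<bar> * \<bar>cos (of_int n * t)\<bar> \<le> 1 * 1" by (intro mult_mono) auto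
    then show "norm (h k t) \<le> \<bar>f k\<bar>" by (simp add: h_def abs_mult mult_left_le)
  qed
  moreover have "(\<Sum>\<^sub>\<infinity>k. h k t) = 0" for t
    using zero[of t] by (simp add: h_def infsum_cmult_left' flip: mult.assoc)
  ultimately have "uniform_limit {-pi..pi} (\<lambda>X t. \<Sum>k\<in>X. h k t) (\<lambda>t. 0) (finite_subsets_at_top UNIV)" by simp
  then obtain I J where I: "\<And>X. ((\<lambda>t. \<Sum>k\<in>X. h k t) has_integral I X) {-pi..pi}"
    and J: "((\<lambda>t::real. 0::real) has_integral J) {-pi..pi}" and lim: "(I \<longlongrightarrow> J) (finite_subsets_at_top UNIV)"
    by (rule uniform_limit_integral) (auto simp: h_def intro!: continuous_intros)
  have "J = 0" using J by simp
  have "I X = 2 * pi * f n" if "finite X" "{n, -n} \<subseteq> X" for X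
  proof -
    have "((\<lambda>t. \<Sum>k\<in>X. h k t) has_integral (\<Sum>k\<in>X. f k * ((if k = n then pi else 0) + (if k = - n then pi else 0)))) {-pi..pi}"
      unfolding h_def by (intro has_integral_sum has_integral_mult_right has_integral_cos_cos_int that)
    then have "I X = (\<Sum>k\<in>X. f k * ((if k = n then pi else 0) + (if k = - n then pi else 0)))"
      using I has_integral_unique by blast
    also have "\<dots> = (\<Sum>k\<in>X. if k = n then f k * pi else 0) + (\<Sum>k\<in>X. if k = - n then f k * pi else 0)"
      by (subst sum.distrib[symmetric], rule sum.cong) (auto simp: distrib_left)
    \<comment> \<open>For \<open>n = 0\<close> both sums pick the same index, so the value is again
      \<open>2 * pi * f n\<close>.\<close>
    also have "\<dots> = 2 * pi * f n" using that by (simp add: sym)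
    finally show ?thesis .
  qed
  then have "eventually (\<lambda>X. I X = 2 * pi * f n) (finite_subsets_at_top UNIV)"
    unfolding eventually_finite_subsets_at_top by (intro exI[of _ "{n, -n}"]) auto
  then have "(I \<longlongrightarrow> 2 * pi * f n) (finite_subsets_at_top UNIV)" by (rule tendsto_eventually)
  then have "2 * pi * f n = 0" using lim \<open>J = 0\<close> by (metis finite_subsets_at_top_neq_bot tendsto_unique)
  then show ?thesis by simp
qed

text \<open>The function \<open>cos (m t) \<rho>\<^sup>j\<close> is harmonic if \<open>\<rho> + 1/\<rho> = 4 - 2 cos t\<close>; this computes the Fourier transform of the kernel.\<close>

lemma poisson_cos:
  fixes t :: real
  defines "A \<equiv> 4 - 2 * cos t"
  shows "(\<Sum>\<^sub>\<infinity>k. poisson_kernel 1 k * cos (of_int k * t)) = (A - sqrt (A\<^sup>2 - 4)) / 2"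
proof -
  \<comment> \<open>The root of \<open>r^2 - A r + 1 = 0\<close> that lies in [0, 1], which keeps
    \<open>F\<close> bounded.\<close>
  define rho where "rho = (A - sqrt (A\<^sup>2 - 4)) / 2"
  have A: "2 \<le> A" using cos_le_one[of t] by (simp add: A_def)
  then have A2: "0 \<le> A\<^sup>2 - 4" using power_mono[of 2 A 2] by simp
  have sq: "rho * rho = A * rho - 1"
    using real_sqrt_mult_self[of "A\<^sup>2 - 4"] A2 by (simp add: rho_def field_simps power2_eq_square)
  have le: "sqrt (A\<^sup>2 - 4) \<le> A" using A by (intro real_le_lsqrt) auto
  have "A - 2 \<le> sqrt (A\<^sup>2 - 4)"
    using A by (intro real_le_rsqrt) (simp add: power2_eq_square algebra_simps)
  then have rho: "0 \<le> rho" "rho \<le> 1" using le by (auto simp: rho_def)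
  define F where "F m j = cos (of_int m * t) * rho ^ j" for m :: int and j :: nat
  have "F 0 1 = poisson 1 (\<lambda>m. F m 0) 0"
  proof (rule half_plane_poisson)
    show "\<bar>F m j\<bar> \<le> 1" for m j
    proof -
      have "\<bar>cos (of_int m * t)\<bar> * \<bar>rho ^ j\<bar> \<le> 1 * 1" using rho by (intro mult_mono) (auto simp: power_le_one)
      then show ?thesis by (simp add: F_def abs_mult)
    qed
    show "4 * F m (Suc j) = F (m + 1) (Suc j) + F (m - 1) (Suc j) + F m (Suc (Suc j)) + F m j" for m j
    proof -
      have "cos (of_int (m + 1) * t) + cos (of_int (m - 1) * t) = 2 * cos t * cos (of_int m * t)"
        by (simp add: distrib_right left_diff_distrib cos_add cos_diff)
      moreover have "rho ^ Suc (Suc j) + rho ^ j = A * rho ^ Suc j"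
      proof -
        have "rho ^ Suc (Suc j) + rho ^ j = (rho * rho + 1) * rho ^ j" by (simp add: algebra_simps)
        then show ?thesis by (simp add: sq)
      qed
      ultimately have "(cos (of_int (m + 1) * t) + cos (of_int (m - 1) * t)) * rho ^ Suc j
         + cos (of_int m * t) * (rho ^ Suc (Suc j) + rho ^ j) = (2 * cos t + A) * (cos (of_int m * t) * rho ^ Suc j)"
        by (simp only: ring_distribs mult_ac)
      moreover have "2 * cos t + A = 4" by (simp add: A_def)
      ultimately show ?thesis unfolding F_def by (simp only: distrib_right distrib_left add.assoc)
    qed
  qed
  then show ?thesis by (simp add: F_def poisson_def rho_def)
qed

section \<open>The factored kernel and its symbol\<close>

definition S_int :: "int \<Rightarrow> real" where
  "S_int k = (if k < 0 then 0 else S_fps $ nat k)"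

lemma S_int_has_sum:
  assumes "summable (\<lambda>n. \<bar>S_fps $ n * v (int n)\<bar>)" "(\<lambda>n. S_fps $ n * v (int n)) sums s"
  shows "((\<lambda>k. S_int k * v k) has_sum s) UNIV"
proof -
  have "((\<lambda>n. S_fps $ n * v (int n)) has_sum s) UNIV"
    using assms by (intro norm_summable_imp_has_sum) auto
  then have "((\<lambda>k. S_int k * v k) \<circ> int has_sum s) UNIV"
    by (simp add: S_int_def o_def)
  then have "((\<lambda>k. S_int k * v k) has_sum s) (range int)"
    by (subst has_sum_reindex) (auto simp: inj_on_def)
  moreover have "S_int k * v k = 0" if "k \<notin> range int" for k
  proof -
    have "k < 0" using that by (metis nonneg_int_cases not_less rangeI)
    then show ?thesis by (simp add: S_int_def)
  qed
  ultimately show ?thesis by (subst has_sum_cong_neutral[where T = "range int" and g = "\<lambda>k. S_int k * v k"]) auto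
qed

lemma S_int_summable: "S_int summable_on UNIV"
  using S_int_has_sum[of "\<lambda>_. 1" "\<Sum>n. S_fps $ n"] summable_S_fps
  by (auto simp: summable_on_def intro!: exI summable_sums intro: summable_rabs_cancel)

lemma summable_S_fps_bounded:
  assumes "\<And>n. \<bar>v n\<bar> \<le> (1::real)"
  shows "summable (\<lambda>n. \<bar>S_fps $ n * v n\<bar>)"
proof (rule summable_comparison_test'[OF summable_S_fps])
  show "norm \<bar>S_fps $ n * v n\<bar> \<le> \<bar>S_fps $ n\<bar>" for n
    using mult_left_mono[OF assms[of n], of "\<bar>S_fps $ n\<bar>"] by (simp add: abs_mult)
qed

text \<open>The convolution kernel with symbol \<open>(\<surd>2 + 1) S(w) S(1/w)\<close>.\<close>

definition factored_kernel :: "int \<Rightarrow> real" where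
  "factored_kernel k = (sqrt 2 + 1) * (\<Sum>\<^sub>\<infinity>i. S_int i * S_int (i + k))"

lemma factored_kernel_summable: "factored_kernel summable_on UNIV"
  unfolding factored_kernel_def using summable_on_cmult_right[OF summable_correlation[OF S_int_summable S_int_summable, of "\<lambda>_. 0" 0]] by simp

lemma factored_kernel_sym: "factored_kernel (- k) = factored_kernel k"
  using infsum_shift_int[of "\<lambda>i. S_int i * S_int (i - k)" k] by (simp add: factored_kernel_def mult.commute)

text \<open>For \<open>v k = u (m - k)\<close> the factorisation becomes two successive convolutions
  of \<open>u\<close>: with \<open>S(w)\<close> inside and with the reflection \<open>S(1/w)\<close>
  outside.\<close>

lemma factored_kernel_apply:
  assumes "\<And>k. \<bar>v k\<bar> \<le> M"
  shows "(\<Sum>\<^sub>\<infinity>k. factored_kernel k * v k) = (sqrt 2 + 1) * (\<Sum>\<^sub>\<infinity>i. S_int i * (\<Sum>\<^sub>\<infinity>j. S_int j * v (j - i)))"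
  unfolding factored_kernel_def mult.assoc infsum_cmult_right'
  using infsum_correlation[OF S_int_summable S_int_summable assms] by simp

text \<open>At \<open>w = cis t\<close> the sum is \<open>(sqrt 2 + 1) |S(w)|^2\<close>. Since
  \<open>|1 - w|^2 = 2 - 2 cos t\<close> and \<open>|1 - alpha w|^2 = alpha (6 - 2 cos t)\<close>,
  one has \<open>|S(w)|^4 = alpha (A^2 - 4)\<close>, and the prefactor cancels
  \<open>sqrt alpha = sqrt 2 - 1\<close>.\<close>

lemma factored_kernel_cos:
  fixes t :: real
  defines "A \<equiv> 4 - 2 * cos t"
  shows "(\<Sum>\<^sub>\<infinity>k. factored_kernel k * cos (of_int k * t)) = sqrt (A\<^sup>2 - 4)"
proof -
  define w where "w = cis t"
  have "(\<lambda>n. of_real (S_fps $ n) * w ^ n) sums csqrt ((1 - w) * (1 - w * of_real alpha))"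
    by (rule S_fps_sums_csqrt) (simp add: w_def)
  moreover define z where "z = csqrt ((1 - w) * (1 - w * of_real alpha))"
  ultimately have z: "(\<lambda>n. of_real (S_fps $ n) * w ^ n) sums z" by simp
  have wn: "Re (w ^ n) = cos (of_int (int n) * t)" "Im (w ^ n) = sin (of_int (int n) * t)" for n
    by (simp_all only: w_def Complex.DeMoivre cis.simps of_int_of_nat_eq)
  have C: "((\<lambda>k. S_int k * cos (of_int k * t)) has_sum Re z) UNIV"
    by (rule S_int_has_sum) (use sums_Re[OF z] in \<open>auto intro!: summable_S_fps_bounded simp: wn\<close>)
  have D: "((\<lambda>k. S_int k * sin (of_int k * t)) has_sum Im z) UNIV"
    by (rule S_int_has_sum) (use sums_Im[OF z] in \<open>auto intro!: summable_S_fps_bounded simp: wn\<close>)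
  \<comment> \<open>The right side is the real part of \<open>z\<close> times the conjugate of
    \<open>w^i\<close>; summing it against \<open>S_int i\<close> produces \<open>z\<close> times
    its conjugate.\<close>
  have inner: "(\<Sum>\<^sub>\<infinity>j. S_int j * cos (of_int (j - i) * t)) = cos (of_int i * t) * Re z + sin (of_int i * t) * Im z" for i
  proof -
    have "((\<lambda>j. cos (of_int i * t) * (S_int j * cos (of_int j * t)) + sin (of_int i * t) * (S_int j * sin (of_int j * t)))
       has_sum (cos (of_int i * t) * Re z + sin (of_int i * t) * Im z)) UNIV"
      by (intro has_sum_add has_sum_cmult_right C D)
    moreover have "cos (of_int i * t) * (S_int j * cos (of_int j * t)) + sin (of_int i * t) * (S_int j * sin (of_int j * t))
       = S_int j * cos (of_int (j - i) * t)" for j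
      by (simp add: left_diff_distrib cos_diff algebra_simps)
    ultimately show ?thesis by (simp add: infsumI)
  qed
  have "((\<lambda>i. (S_int i * cos (of_int i * t)) * Re z + (S_int i * sin (of_int i * t)) * Im z) has_sum (Re z * Re z + Im z * Im z)) UNIV"
    by (intro has_sum_add has_sum_cmult_left C D)
  then have "(\<Sum>\<^sub>\<infinity>i. S_int i * (\<Sum>\<^sub>\<infinity>j. S_int j * cos (of_int (j - i) * t))) = Re z * Re z + Im z * Im z"
    unfolding inner by (intro infsumI) (simp add: distrib_left mult.assoc)
  also have "\<dots> = (cmod z)\<^sup>2" unfolding cmod_power2 by (simp only: power2_eq_square)
  also have "\<dots> = cmod ((1 - w) * (1 - w * of_real alpha))"
    unfolding norm_power[symmetric] z_def by simp
  also have "\<dots> = sqrt ((cmod (1 - w))\<^sup>2 * (cmod (1 - w * of_real alpha))\<^sup>2)"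
    by (simp add: norm_mult real_sqrt_mult)
  also have "(cmod (1 - w))\<^sup>2 = 2 - 2 * cos t"
    unfolding cmod_power2 w_def using sin_cos_squared_add[of t] by (simp add: power2_eq_square algebra_simps)
  also have "(cmod (1 - w * of_real alpha))\<^sup>2 = alpha * (6 - 2 * cos t)"
  proof -
    have gen: "(1 - a * c)\<^sup>2 + (- (a * s))\<^sup>2 = 1 - 2 * a * c + a * a * (s\<^sup>2 + c\<^sup>2)" for a c s :: real
      by (simp add: power2_eq_square algebra_simps)
    have "Re (1 - w * of_real alpha) = 1 - alpha * cos t" "Im (1 - w * of_real alpha) = - (alpha * sin t)"
      by (simp_all add: w_def mult.commute)
    then have "(cmod (1 - w * of_real alpha))\<^sup>2 = 1 - 2 * alpha * cos t + alpha * alpha"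
      unfolding cmod_power2 by (simp only: gen sin_cos_squared_add mult_1_right)
    then show ?thesis by (simp add: alpha_square algebra_simps)
  qed
  also have "(2 - 2 * cos t) * (alpha * (6 - 2 * cos t)) = alpha * (A\<^sup>2 - 4)"
    by (simp add: A_def power2_eq_square algebra_simps)
  also have "sqrt (alpha * (A\<^sup>2 - 4)) = (sqrt 2 - 1) * sqrt (A\<^sup>2 - 4)"
    by (simp add: real_sqrt_mult alpha_def)
  finally have "(\<Sum>\<^sub>\<infinity>i. S_int i * (\<Sum>\<^sub>\<infinity>j. S_int j * cos (of_int (j - i) * t))) = (sqrt 2 - 1) * sqrt (A\<^sup>2 - 4)" .
  moreover have "(sqrt 2 + 1) * (sqrt 2 - 1) = (1::real)" by (simp add: algebra_simps)
  ultimately show ?thesis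
    by (subst factored_kernel_apply[of _ 1]) (simp_all flip: mult.assoc)
qed

text \<open>Convolution with this kernel computes, on the axis, 4 times the difference between a bounded function and the average
  of its harmonic extension to both half-planes over the neighbours.\<close>

definition axis_kernel :: "int \<Rightarrow> real" where
  "axis_kernel k = (if k = 0 then 4 else 0) - (if k = 1 then 1 else 0) - (if k = - 1 then 1 else 0) - 2 * poisson_kernel 1 k"

lemma axis_kernel_has_sum:
  assumes "\<And>k. \<bar>v k\<bar> \<le> M"
  shows "((\<lambda>k. axis_kernel k * v k) has_sum (4 * v 0 - v 1 - v (-1) - 2 * (\<Sum>\<^sub>\<infinity>k. poisson_kernel 1 k * v k))) UNIV"
proof -
  have delta: "((\<lambda>k. (if k = a then c else 0) * v k) has_sum (c * v a)) UNIV" for a :: int and c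
  proof -
    have "((\<lambda>k. (if k = a then c else 0) * v k) has_sum (c * v a)) {a}" by (intro has_sum_finiteI) auto
    then show ?thesis by (subst has_sum_cong_neutral[where T = "{a}" and g = "\<lambda>k. (if k = a then c else 0) * v k"]) auto
  qed
  have p: "((\<lambda>k. poisson_kernel 1 k * v k) has_sum (\<Sum>\<^sub>\<infinity>k. poisson_kernel 1 k * v k)) UNIV"
    by (rule has_sum_infsum[OF summable_on_mult_bounded[OF poisson_kernel_summable assms]])
  have "((\<lambda>k. (if k = 0 then 4 else 0) * v k + (- 1) * ((if k = 1 then 1 else 0) * v k) + (- 1) * ((if k = - 1 then 1 else 0) * v k)
     + (- 2) * (poisson_kernel 1 k * v k)) has_sum (4 * v 0 + (- 1) * (1 * v 1) + (- 1) * (1 * v (- 1)) + (- 2) * (\<Sum>\<^sub>\<infinity>k. poisson_kernel 1 k * v k))) UNIV"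
    by (intro has_sum_add has_sum_cmult_right delta p)
  then show ?thesis by (simp add: axis_kernel_def left_diff_distrib mult.assoc)
qed

text \<open>Both kernels are summable, even and have the cosine transform
  \<open>sqrt (A^2 - 4)\<close>: in \<open>axis_kernel\<close> the part \<open>A\<close> cancels
  against the transform of the Poisson kernel. This replaces an explicit formula for
  \<open>poisson_kernel 1\<close>.\<close>

lemma axis_kernel_eq_factored_kernel: "axis_kernel k = factored_kernel k"
proof -
  have X: "axis_kernel summable_on UNIV" using axis_kernel_has_sum[of "\<lambda>_. 1" 1] by (auto simp: summable_on_def)
  have s: "(\<lambda>k. axis_kernel k - factored_kernel k) summable_on UNIV"
    using summable_on_add[OF X factored_kernel_summable[THEN summable_on_uminus[THEN iffD2]]] by simp
  have "axis_kernel k - factored_kernel k = 0"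
  proof (rule cos_series_unique[OF s])
    show "axis_kernel (- k) - factored_kernel (- k) = axis_kernel k - factored_kernel k" for k
      by (simp add: factored_kernel_sym axis_kernel_def poisson_kernel_sym equation_minus_iff[of _ k] minus_equation_iff)
    show "(\<Sum>\<^sub>\<infinity>k. (axis_kernel k - factored_kernel k) * cos (of_int k * t)) = 0" for t
    proof -
      define A where "A = 4 - 2 * cos t"
      have "((\<lambda>k. axis_kernel k * cos (of_int k * t)) has_sum (A - 2 * ((A - sqrt (A\<^sup>2 - 4)) / 2))) UNIV"
        using axis_kernel_has_sum[of "\<lambda>k. cos (of_int k * t)" 1] unfolding poisson_cos[of t] A_def by simp
      then have "((\<lambda>k. axis_kernel k * cos (of_int k * t)) has_sum sqrt (A\<^sup>2 - 4)) UNIV" by (simp add: field_simps)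
      moreover have "((\<lambda>k. factored_kernel k * cos (of_int k * t)) has_sum sqrt (A\<^sup>2 - 4)) UNIV"
        using has_sum_infsum[OF summable_on_mult_bounded[OF factored_kernel_summable, of "\<lambda>k. cos (of_int k * t)" 1]] factored_kernel_cos[of t]
        by (simp add: A_def)
      ultimately have "((\<lambda>k. axis_kernel k * cos (of_int k * t) + - (factored_kernel k * cos (of_int k * t))) has_sum
         (sqrt (A\<^sup>2 - 4) + - sqrt (A\<^sup>2 - 4))) UNIV"
        by (intro has_sum_add has_sum_uminusI)
      then show ?thesis by (simp add: infsumI left_diff_distrib)
    qed
  qed
  then show ?thesis by simp
qed


section \<open>Explicit solution of the axis equation\<close>

definition R_int :: "int \<Rightarrow> real" where
  "R_int k = (if k < 0 then 0 else R_fps $ nat k)"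

lemma R_int_bounded: obtains C where "\<And>k. \<bar>R_int k\<bar> \<le> C" "0 \<le> C"
proof -
  obtain C where C: "\<And>n. \<bar>R_fps $ n\<bar> \<le> C" using R_fps_bounded by blast
  have "0 \<le> C" using C[of 0] by linarith
  then have "\<bar>R_int k\<bar> \<le> C" for k using C by (simp add: R_int_def)
  then show ?thesis using that \<open>0 \<le> C\<close> by blast
qed

lemma S_int_R_int_convolution: "(\<Sum>\<^sub>\<infinity>j. S_int j * R_int (n - j)) = (if n = 0 then 1 else 0)"
proof (cases "n < 0")
  case True
  then have "S_int j * R_int (n - j) = 0" for j by (simp add: S_int_def R_int_def)
  then show ?thesis using True by (simp only: infsum_0_simp) simp
next
  case False
  have "(\<Sum>\<^sub>\<infinity>j. S_int j * R_int (n - j)) = (\<Sum>\<^sub>\<infinity>j\<in>int ` {0..nat n}. S_int j * R_int (n - j))"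
  proof (rule infsum_cong_neutral)
    fix j assume "j \<in> UNIV - int ` {0..nat n}"
    then have "j \<notin> int ` {0..nat n}" by simp
    moreover have "j \<in> int ` {0..nat n}" if "0 \<le> j" "j \<le> n"
      using that by (intro image_eqI[of _ _ "nat j"]) auto
    ultimately have "j < 0 \<or> n < j" by linarith
    then show "S_int j * R_int (n - j) = 0" by (auto simp: S_int_def R_int_def)
  qed auto
  also have "\<dots> = (\<Sum>j\<in>int ` {0..nat n}. S_int j * R_int (n - j))" by simp
  also have "\<dots> = (\<Sum>i=0..nat n. S_int (int i) * R_int (n - int i))"
    by (subst sum.reindex) (auto simp: inj_on_def)
  also have "\<dots> = (\<Sum>i=0..nat n. S_fps $ i * R_fps $ (nat n - i))"
  proof (rule sum.cong[OF refl])
    fix i assume "i \<in> {0..nat n}"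
    then have "\<not> n - int i < 0" "nat (n - int i) = nat n - i" using False by auto
    then show "S_int (int i) * R_int (n - int i) = S_fps $ i * R_fps $ (nat n - i)" by (simp add: S_int_def R_int_def)
  qed
  also have "\<dots> = (S_fps * R_fps) $ nat n" by (simp add: fps_mult_nth)
  also have "\<dots> = (if n = 0 then 1 else 0)" using False by (simp add: S_fps_times_R_fps)
  finally show ?thesis .
qed

context
  fixes x :: real
  assumes x: "0 < x" "x < 1"
begin

lemma power_has_sum: "((\<lambda>k::nat. x ^ k) has_sum (1 / (1 - x))) UNIV"
  using x by (intro norm_summable_imp_has_sum) (auto intro!: summable_geometric geometric_sums)

text \<open>The coefficients of \<open>w\<^sup>m\<close> in \<open>1 / (S(w) (1 - x/w))\<close>.\<close>

definition axis_fun :: "int \<Rightarrow> real" where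
  "axis_fun m = (\<Sum>\<^sub>\<infinity>k::nat. x ^ k * R_int (m + int k))"

lemma axis_fun_summable: "(\<lambda>k::nat. x ^ k * R_int (m + int k)) summable_on UNIV"
proof -
  obtain C where "\<And>k. \<bar>R_int k\<bar> \<le> C" using R_int_bounded by blast
  then show ?thesis
    using power_has_sum by (intro summable_on_mult_bounded[where M = C]) (auto simp: summable_on_def)
qed

text \<open>Only the values of \<open>R_int\<close> from \<open>m\<close> on enter
  \<open>axis_fun m\<close>; combined with the decay of \<open>R_fps\<close> this gives the limit 0
  at infinity.\<close>

lemma axis_fun_bound_from:
  assumes "\<And>k. k \<ge> m \<Longrightarrow> \<bar>R_int k\<bar> \<le> C"
  shows "\<bar>axis_fun m\<bar> \<le> C / (1 - x)"
proof -
  have "((\<lambda>k::nat. x ^ k * C) has_sum (1 / (1 - x) * C)) UNIV"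
    by (rule has_sum_cmult_left[OF power_has_sum])
  moreover have "norm (x ^ k * R_int (m + int k)) \<le> x ^ k * C" for k
    using assms[of "m + int k"] x by (simp add: abs_mult mult_left_mono)
  ultimately have "norm (axis_fun m) \<le> 1 / (1 - x) * C"
    unfolding axis_fun_def using norm_infsum_le[OF has_sum_infsum[OF axis_fun_summable] ] by blast
  then show ?thesis by simp
qed

lemma axis_fun_bounded: obtains C where "\<And>m. \<bar>axis_fun m\<bar> \<le> C"
  using R_int_bounded axis_fun_bound_from by metis

lemma axis_fun_tendsto_0: "(\<lambda>n. axis_fun (int n)) \<longlonglongrightarrow> 0"
proof (rule LIMSEQ_I)
  fix e :: real assume e: "0 < e"
  define d where "d = e * (1 - x) / 2"
  have "0 < d" using e x by (simp add: d_def)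
  then obtain N where N: "\<And>n. n \<ge> N \<Longrightarrow> \<bar>R_fps $ n\<bar> < d"
    using LIMSEQ_D[OF R_fps_tendsto_0] by fastforce
  have "norm (axis_fun (int n) - 0) < e" if "n \<ge> N" for n
  proof -
    have "\<bar>R_int k\<bar> \<le> d" if "k \<ge> int n" for k
      using N[of "nat k"] that \<open>n \<ge> N\<close> by (simp add: R_int_def le_nat_iff)
    then have "\<bar>axis_fun (int n)\<bar> \<le> d / (1 - x)" by (rule axis_fun_bound_from)
    also have "\<dots> = e / 2" using x by (simp add: d_def divide_simps)
    also have "\<dots> < e" using e by simp
    finally show ?thesis by simp
  qed
  then show "\<exists>N. \<forall>n\<ge>N. norm (axis_fun (int n) - 0) < e" by blast
qed

text \<open>\<open>R_int\<close> vanishes to the left of 0, so the sum starts at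
  \<open>k = m\<close> and is \<open>x^m\<close> times the whole series of \<open>1/S\<close>. Up to
  the factor \<open>S_fun x\<close> this is the boundary data on the slit.\<close>

lemma axis_fun_nonpos: "axis_fun (- int m) = x ^ m / S_fun x"
proof -
  have "summable (\<lambda>n. norm (R_fps $ n * x ^ n))"
  proof -
    obtain C where C: "\<And>n. \<bar>R_fps $ n\<bar> \<le> C" using R_fps_bounded by blast
    show ?thesis
    proof (rule summable_comparison_test'[where N = 0])
      show "summable (\<lambda>n. C * x ^ n)" using x by (intro summable_mult summable_geometric) auto
      show "norm (norm (R_fps $ n * x ^ n)) \<le> C * x ^ n" for n
        using C[of n] x by (simp add: abs_mult mult_right_mono)
    qed
  qed
  then have "((\<lambda>n. R_fps $ n * x ^ n) has_sum inverse (S_fun x)) UNIV"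
    using R_fps_sums[of x] x by (intro norm_summable_imp_has_sum) auto
  then have h: "((\<lambda>n. x ^ m * (R_fps $ n * x ^ n)) has_sum (x ^ m * inverse (S_fun x))) UNIV"
    by (rule has_sum_cmult_right)
  have "((\<lambda>k. x ^ k * R_int (- int m + int k)) \<circ> (\<lambda>n. n + m) has_sum (x ^ m * inverse (S_fun x))) UNIV"
    using h by (simp add: o_def R_int_def power_add mult_ac)
  then have "((\<lambda>k. x ^ k * R_int (- int m + int k)) has_sum (x ^ m * inverse (S_fun x))) (range (\<lambda>n. n + m))"
    by (subst has_sum_reindex) (auto simp: inj_on_def)
  moreover have "x ^ k * R_int (- int m + int k) = 0" if "k \<notin> range (\<lambda>n. n + m)" for k
  proof -
    have "k < m" using that by (metis le_add_diff_inverse2 not_less rangeI)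
    then show ?thesis by (simp add: R_int_def)
  qed
  ultimately have "((\<lambda>k. x ^ k * R_int (- int m + int k)) has_sum (x ^ m * inverse (S_fun x))) UNIV"
    by (subst has_sum_cong_neutral[where T = "range (\<lambda>n. n + m)" and g = "\<lambda>k. x ^ k * R_int (- int m + int k)"]) auto
  then show ?thesis by (simp add: axis_fun_def infsumI divide_inverse)
qed

text \<open>Here the sum is a tail of the series of \<open>1/S\<close>. Multiplied by
  \<open>S_fun x\<close> it becomes 1 minus a polynomial times \<open>S_fun x\<close>: the origin of
  the form \<open>f - g S\<close> on the axis.\<close>

lemma axis_fun_nonneg: "x ^ m * axis_fun (int m) = inverse (S_fun x) - (\<Sum>l<m. R_fps $ l * x ^ l)"
proof -
  have "(\<lambda>k. x ^ k * R_int (int m + int k)) sums axis_fun (int m)"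
    unfolding axis_fun_def by (rule has_sum_imp_sums) (rule has_sum_infsum[OF axis_fun_summable])
  then have "(\<lambda>k. x ^ m * (x ^ k * R_int (int m + int k))) sums (x ^ m * axis_fun (int m))" by (rule sums_mult)
  moreover have "R_int (int m + int k) = R_fps $ (k + m)" for k
    by (simp add: R_int_def nat_add_distrib add.commute)
  ultimately have "(\<lambda>k. R_fps $ (k + m) * x ^ (k + m)) sums (x ^ m * axis_fun (int m))"
    by (simp add: power_add mult_ac)
  moreover have "(\<lambda>k. R_fps $ (k + m) * x ^ (k + m)) sums (inverse (S_fun x) - (\<Sum>l<m. R_fps $ l * x ^ l))"
    using R_fps_sums[of x] x by (subst sums_iff_shift) auto
  ultimately show ?thesis using sums_unique2 by blast
qed

text \<open>The coefficients of \<open>1 / (1 - x/w)\<close>.\<close>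

definition left_powers :: "int \<Rightarrow> real" where
  "left_powers n = (if n \<le> 0 then x ^ nat (- n) else 0)"

text \<open>Convolving with \<open>S_int\<close> cancels the factor \<open>1/S(w)\<close>. The
  interchange of sums rests on the summable product of \<open>S_int\<close> and the powers of
  \<open>x\<close>, while \<open>R_int\<close> is only bounded.\<close>

lemma S_int_axis_fun_convolution: "(\<Sum>\<^sub>\<infinity>j. S_int j * axis_fun (n - j)) = left_powers n"
proof -
  obtain C where C: "\<And>k. \<bar>R_int k\<bar> \<le> C" using R_int_bounded by blast
  have "(\<lambda>(j, k). S_int j * x ^ k) summable_on UNIV \<times> (UNIV :: nat set)"
    using summable_on_product_real[OF S_int_summable, of "\<lambda>k. x ^ k" UNIV] power_has_sum
    by (auto simp: summable_on_def)
  then have "(\<lambda>p. (case p of (j, k) \<Rightarrow> S_int j * x ^ k) * (case p of (j, k) \<Rightarrow> R_int (n - j + int k)))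
       summable_on UNIV \<times> (UNIV :: nat set)"
    by (rule summable_on_mult_bounded[where M = C]) (auto simp: C)
  then have s: "(\<lambda>(j, k). S_int j * (x ^ k * R_int (n - j + int k))) summable_on UNIV \<times> (UNIV :: nat set)"
    by (simp add: case_prod_unfold mult.assoc)
  have "(\<Sum>\<^sub>\<infinity>j. S_int j * axis_fun (n - j)) = (\<Sum>\<^sub>\<infinity>j. \<Sum>\<^sub>\<infinity>k. S_int j * (x ^ k * R_int (n - j + int k)))"
    by (simp add: axis_fun_def infsum_cmult_right')
  also have "\<dots> = (\<Sum>\<^sub>\<infinity>k. \<Sum>\<^sub>\<infinity>j. S_int j * (x ^ k * R_int (n - j + int k)))"
    by (rule infsum_swap_banach[OF s])
  also have "\<dots> = (\<Sum>\<^sub>\<infinity>k. x ^ k * (\<Sum>\<^sub>\<infinity>j. S_int j * R_int (n + int k - j)))"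
    by (subst infsum_cmult_right'[symmetric]) (simp add: mult.left_commute algebra_simps)
  also have "\<dots> = (\<Sum>\<^sub>\<infinity>k::nat. x ^ k * (if n + int k = 0 then 1 else 0))"
    by (simp add: S_int_R_int_convolution)
  also have "\<dots> = left_powers n"
  proof (cases "n \<le> 0")
    case True
    have "(\<Sum>\<^sub>\<infinity>k::nat. x ^ k * (if n + int k = 0 then 1 else 0)) = (\<Sum>\<^sub>\<infinity>k\<in>{nat (- n)}. x ^ k * (if n + int k = 0 then 1 else 0))"
      by (rule infsum_cong_neutral) auto
    then show ?thesis using True by (simp add: left_powers_def)
  next
    case False
    then have "n + int k \<noteq> 0" for k by simp
    then show ?thesis using False by (simp add: left_powers_def)
  qed
  finally show ?thesis .
qed

text \<open>The coefficients of \<open>(sqrt 2 + 1) S(1/w) / (1 - x/w)\<close>, a series without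
  positive powers of \<open>w\<close>.\<close>

definition axis_defect :: "int \<Rightarrow> real" where
  "axis_defect m = (if m \<le> 0 then (sqrt 2 + 1) * (\<Sum>i\<le>nat (- m). S_fps $ i * x ^ (nat (- m) - i)) else 0)"

lemma S_int_left_powers: "(sqrt 2 + 1) * (\<Sum>\<^sub>\<infinity>i. S_int i * left_powers (m + i)) = axis_defect m"
proof (cases "m \<le> 0")
  case False
  then have "S_int i * left_powers (m + i) = 0" for i by (simp add: S_int_def left_powers_def)
  then show ?thesis using False by (simp only: infsum_0_simp axis_defect_def) simp
next
  case True
  have "(\<Sum>\<^sub>\<infinity>i. S_int i * left_powers (m + i)) = (\<Sum>\<^sub>\<infinity>i\<in>int ` {..nat (- m)}. S_int i * left_powers (m + i))"
  proof (rule infsum_cong_neutral)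
    fix i assume "i \<in> UNIV - int ` {..nat (- m)}"
    then have "i \<notin> int ` {..nat (- m)}" by simp
    moreover have "i \<in> int ` {..nat (- m)}" if "0 \<le> i" "i \<le> - m"
      using that by (intro image_eqI[of _ _ "nat i"]) auto
    ultimately have "i < 0 \<or> 0 < m + i" by linarith
    then show "S_int i * left_powers (m + i) = 0" by (auto simp: S_int_def left_powers_def)
  qed auto
  also have "\<dots> = (\<Sum>i\<in>int ` {..nat (- m)}. S_int i * left_powers (m + i))" by simp
  also have "\<dots> = (\<Sum>i\<le>nat (- m). S_int (int i) * left_powers (m + int i))"
    by (subst sum.reindex) (auto simp: inj_on_def)
  also have "\<dots> = (\<Sum>i\<le>nat (- m). S_fps $ i * x ^ (nat (- m) - i))"
  proof (rule sum.cong[OF refl])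
    fix i assume "i \<in> {..nat (- m)}"
    then have "m + int i \<le> 0" "nat (- (m + int i)) = nat (- m) - i" using True by auto
    then show "S_int (int i) * left_powers (m + int i) = S_fps $ i * x ^ (nat (- m) - i)"
      unfolding left_powers_def by (simp add: S_int_def)
  qed
  finally show ?thesis using True by (simp add: axis_defect_def)
qed

text \<open>For \<open>m > 0\<close> the right side is 0 and this is harmonicity on the free
  half-axis; for \<open>m \<le> 0\<close> it is the explicit value that later determines row 1 above
  the slit.\<close>

lemma axis_fun_equation: "4 * axis_fun m - axis_fun (m + 1) - axis_fun (m - 1) - 2 * poisson 1 axis_fun m = axis_defect m"
proof -
  obtain C where C: "\<And>m. \<bar>axis_fun m\<bar> \<le> C" using axis_fun_bounded by blast
  have "4 * axis_fun m - axis_fun (m - 1) - axis_fun (m + 1) - 2 * poisson 1 axis_fun m = (\<Sum>\<^sub>\<infinity>k. axis_kernel k * axis_fun (m - k))"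
    using axis_kernel_has_sum[of "\<lambda>k. axis_fun (m - k)" C] C by (simp add: infsumI poisson_def)
  also have "\<dots> = (\<Sum>\<^sub>\<infinity>k. factored_kernel k * axis_fun (m - k))" by (simp add: axis_kernel_eq_factored_kernel)
  also have "\<dots> = (sqrt 2 + 1) * (\<Sum>\<^sub>\<infinity>i. S_int i * (\<Sum>\<^sub>\<infinity>j. S_int j * axis_fun (m - (j - i))))"
    by (rule factored_kernel_apply) (rule C)
  also have "\<dots> = (sqrt 2 + 1) * (\<Sum>\<^sub>\<infinity>i. S_int i * left_powers (m + i))"
  proof -
    have "m - (j - i) = (m + i) - j" for i j by simp
    then show ?thesis by (simp only: S_int_axis_fun_convolution)
  qed
  finally show ?thesis by (simp add: S_int_left_powers)
qed

end

section \<open>Uniqueness on the axis: maximum principle and barrier\<close>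

lemma eventually_at_left_1: "eventually (\<lambda>x::real. 0 < x \<and> x < 1) (at_left 1)"
  unfolding eventually_at_left[OF zero_less_one] by (auto intro!: exI[of _ 0])

text \<open>The two closed forms give a power of \<open>x\<close> for \<open>m \<le> 0\<close>, and
  for \<open>m > 0\<close> a quotient whose only contribution besides 1 carries a factor
  \<open>S_fun x\<close>, which tends to 0.\<close>

lemma axis_fun_tendsto_1: "((\<lambda>x. S_fun x * axis_fun x m) \<longlongrightarrow> 1) (at_left 1)"
proof -
  have S: "(S_fun \<longlongrightarrow> 0) (at_left 1)"
  proof -
    have "((\<lambda>x. sqrt ((1 - x) * (1 - alpha * x))) \<longlongrightarrow> sqrt ((1 - 1) * (1 - alpha * 1))) (at_left 1)"
      by (intro tendsto_intros)
    then show ?thesis by (simp add: S_fun_def[abs_def])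
  qed
  show ?thesis
  proof (cases "m \<le> 0")
    case True
    have "((\<lambda>x::real. x ^ nat (- m)) \<longlongrightarrow> 1 ^ nat (- m)) (at_left 1)" by (intro tendsto_intros)
    moreover have "eventually (\<lambda>x. x ^ nat (- m) = S_fun x * axis_fun x m) (at_left 1)"
      using eventually_at_left_1
    proof eventually_elim
      case (elim x)
      then show ?case using axis_fun_nonpos[of x "nat (- m)"] True S_fun_pos[of x] by simp
    qed
    ultimately show ?thesis by (simp add: filterlim_cong)
  next
    case False
    define n where "n = nat m"
    have m: "m = int n" using False by (simp add: n_def)
    have "((\<lambda>x::real. (1 - S_fun x * (\<Sum>l<n. R_fps $ l * x ^ l)) / x ^ n) \<longlongrightarrow> (1 - 0 * (\<Sum>l<n. R_fps $ l * 1 ^ l)) / 1 ^ n) (at_left 1)"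
      by (intro tendsto_intros S) auto
    moreover have "eventually (\<lambda>x. (1 - S_fun x * (\<Sum>l<n. R_fps $ l * x ^ l)) / x ^ n = S_fun x * axis_fun x m) (at_left 1)"
      using eventually_at_left_1
    proof eventually_elim
      case (elim x)
      have "S_fun x * (x ^ n * axis_fun x m) = 1 - S_fun x * (\<Sum>l<n. R_fps $ l * x ^ l)"
        using axis_fun_nonneg[of x n] elim S_fun_pos[of x] by (simp add: m right_diff_distrib)
      then show ?case using elim by (simp add: field_simps)
    qed
    ultimately show ?thesis by (simp add: filterlim_cong)
  qed
qed

text \<open>The constant 1 is its own bounded harmonic extension, so the kernel of height 1 loses no
  mass.\<close>

lemma poisson_const: "poisson 1 (\<lambda>_. 1) m = 1"
  using half_plane_poisson[of "\<lambda>_ _. 1" 1 m 1] by simp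

lemma poisson_linear:
  assumes "\<And>m. \<bar>v m\<bar> \<le> M" "\<And>m. \<bar>w m\<bar> \<le> N"
  shows "poisson j (\<lambda>m. v m + c * w m) m = poisson j v m + c * poisson j w m"
proof -
  have "((\<lambda>k. poisson_kernel j k * v (m - k) + c * (poisson_kernel j k * w (m - k))) has_sum (poisson j v m + c * poisson j w m)) UNIV"
    unfolding poisson_def
    by (intro has_sum_add has_sum_cmult_right has_sum_infsum poisson_summable[of v M] poisson_summable[of w N] assms)
  moreover have "poisson_kernel j k * v (m - k) + c * (poisson_kernel j k * w (m - k)) = poisson_kernel j k * (v (m - k) + c * w (m - k))" for k
    by (simp add: algebra_simps)
  ultimately show ?thesis by (simp add: poisson_def infsumI)
qed

lemma poisson_le:
  assumes "\<And>m. \<bar>v m\<bar> \<le> M" "\<And>m. v m \<le> B"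
  shows "poisson 1 v m \<le> B"
proof -
  have "poisson 1 v m \<le> poisson 1 (\<lambda>_. 0 + B * 1) m"
    unfolding poisson_def
    by (rule infsum_mono) (auto intro!: mult_left_mono assms(2) poisson_kernel_nonneg summable_on_cmult_left poisson_kernel_summable poisson_summable[of v M] assms(1))
  also have "\<dots> = B"
    using poisson_linear[of "\<lambda>_. 0" 0 "\<lambda>_. 1" 1 1 B m] poisson_const[of m] by (simp add: poisson_def[of _ "\<lambda>_. 0"])
  finally show ?thesis .
qed

text \<open>A positive supremum would be attained, since positive values occur at finitely many
  sites only; at a maximum in the free region the left neighbour attains it too, and this descent
  ends on the slit.\<close>

lemma axis_max_principle:
  fixes w :: "int \<Rightarrow> real"
  assumes bound: "\<And>m. \<bar>w m\<bar> \<le> M"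
    and neg: "\<And>m. m \<le> 0 \<Longrightarrow> w m \<le> 0"
    and far: "eventually (\<lambda>n. w (int n) \<le> 0) sequentially"
    and harm: "\<And>m. m > 0 \<Longrightarrow> 4 * w m = w (m + 1) + w (m - 1) + 2 * poisson 1 w m"
  shows "w m \<le> 0"
proof (rule ccontr)
  assume "\<not> w m \<le> 0"
  then have wm: "0 < w m" by simp
  obtain N where N: "\<And>n. n \<ge> N \<Longrightarrow> w (int n) \<le> 0" using far unfolding eventually_sequentially by blast
  have inside: "0 < k \<and> k < int N" if "0 < w k" for k
    using neg[of k] N[of "nat k"] that by (metis int_nat_eq leI le_nat_iff less_le_not_le)
  define B where "B = Max (w ` {0..int N})"
  have Bge: "w k \<le> B" if "k \<in> {0..int N}" for k unfolding B_def using that by (intro Max_ge) auto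
  have "0 < B" using Bge[of m] wm inside[OF wm] by simp
  have le: "w k \<le> B" for k
    using Bge[of k] inside[of k] \<open>0 < B\<close> by (cases "0 < w k") auto
  have "B \<in> w ` {0..int N}" unfolding B_def by (intro Max_in) auto
  then obtain k0 where "w k0 = B" by blast
  \<comment> \<open>In the equation for \<open>4 * w k\<close> the right neighbour and the Poisson
    term give at most \<open>3 * B\<close>, so the left neighbour cannot fall below
    \<open>B\<close>.\<close>
  have "w (k0 - int i) = B" for i
  proof (induction i)
    case (Suc i)
    define k where "k = k0 - int i"
    have "w k = B" using Suc by (simp add: k_def)
    then have "0 < k" using inside[of k] \<open>0 < B\<close> by simp
    then have "4 * B \<le> B + w (k - 1) + 2 * B"
      using harm[of k] le[of "k + 1"] poisson_le[of w M B k, OF bound le] \<open>w k = B\<close> by linarith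
    then have "w (k - 1) = B" using le[of "k - 1"] by linarith
    moreover have "k - 1 = k0 - int (Suc i)" by (simp add: k_def)
    ultimately show ?case by simp
  qed (simp add: \<open>w k0 = B\<close>)
  \<comment> \<open>The site \<open>k0 - int (nat k0)\<close> is nonpositive in every case, so
    \<open>neg\<close> contradicts the value \<open>B\<close> there.\<close>
  from this[of "nat k0"] have "0 < w (k0 - int (nat k0))" using \<open>0 < B\<close> by simp
  then show False using neg[of "k0 - int (nat k0)"] int_nat_eq[of k0] by linarith
qed

text \<open>The barrier \<open>1 - S(x) axis_fun x m\<close> is nonnegative for \<open>m \<le> 0\<close>, tends to 1 as \<open>m \<rightarrow> \<infinity>\<close>, and tends to 0 for
  fixed \<open>m\<close> as \<open>x \<rightarrow> 1\<close>. It takes the place of the recurrence of the walk.\<close>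

lemma axis_nonpos:
  fixes v :: "int \<Rightarrow> real"
  assumes bound: "\<And>m. \<bar>v m\<bar> \<le> M"
    and zero: "\<And>m. m \<le> 0 \<Longrightarrow> v m = 0"
    and harm: "\<And>m. m > 0 \<Longrightarrow> 4 * v m = v (m + 1) + v (m - 1) + 2 * poisson 1 v m"
  shows "v m \<le> 0"
proof -
  \<comment> \<open>Any constant above \<open>M\<close> works: the barrier tends to 1 for large
    \<open>m\<close>, so \<open>K\<close> times it eventually dominates \<open>v\<close>.\<close>
  define K where "K = M + 1"
  have "0 \<le> M" using bound[of 0] by linarith
  then have K: "0 < K" by (simp add: K_def)
  have le: "v m \<le> K * (1 - S_fun x * axis_fun x m)" if x: "0 < x" "x < 1" for x
  proof -
    obtain C where C: "\<And>m. \<bar>axis_fun x m\<bar> \<le> C" using axis_fun_bounded[OF x] by blast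
    define S where "S = S_fun x"
    have S: "0 < S" using S_fun_pos[of x] x by (simp add: S_def)
    define b where "b m = 1 + (- S) * axis_fun x m" for m
    have b_bound: "\<bar>b m\<bar> \<le> 1 + S * C" for m
    proof -
      have "\<bar>b m\<bar> \<le> 1 + \<bar>(- S) * axis_fun x m\<bar>" unfolding b_def by linarith
      also have "\<bar>(- S) * axis_fun x m\<bar> \<le> S * C" using C[of m] S by (simp add: abs_mult)
      finally show ?thesis by simp
    qed
    have pb: "poisson 1 b m = 1 + (- S) * poisson 1 (axis_fun x) m" for m
      unfolding b_def using poisson_linear[of "\<lambda>_. 1" 1 "axis_fun x" C 1 "- S" m] C poisson_const by simp
    define w where "w m = v m + (- K) * b m" for m
    have "w m \<le> 0"
    proof (rule axis_max_principle[where M = "M + K * (1 + S * C)"])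
      show "\<bar>w m\<bar> \<le> M + K * (1 + S * C)" for m
      proof -
        have "\<bar>w m\<bar> \<le> \<bar>v m\<bar> + \<bar>(- K) * b m\<bar>" unfolding w_def by linarith
        also have "\<bar>(- K) * b m\<bar> \<le> K * (1 + S * C)" using b_bound[of m] K by (simp add: abs_mult)
        finally show ?thesis using bound[of m] by linarith
      qed
      show "w m \<le> 0" if "m \<le> 0" for m
      proof -
        have "S * axis_fun x m = x ^ nat (- m)" using axis_fun_nonpos[OF x, of "nat (- m)"] that S by (simp add: S_def)
        moreover have "x ^ nat (- m) \<le> 1" using x by (intro power_le_one) auto
        ultimately have "0 \<le> b m" by (simp add: b_def)
        then show ?thesis using K zero[OF that] by (simp add: w_def)
      qed
      show "eventually (\<lambda>n. w (int n) \<le> 0) sequentially"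
      proof -
        have "(\<lambda>n. K * (1 + (- S) * axis_fun x (int n))) \<longlonglongrightarrow> K * (1 + (- S) * 0)"
          by (intro tendsto_intros axis_fun_tendsto_0 x)
        moreover have "M < K * (1 + (- S) * 0)" by (simp add: K_def)
        ultimately have "eventually (\<lambda>n. M < K * (1 + (- S) * axis_fun x (int n))) sequentially"
          by (rule order_tendstoD)
        then show ?thesis
        proof eventually_elim
          case (elim n)
          then show ?case using bound[of "int n"] by (simp add: w_def b_def)
        qed
      qed
      show "4 * w m = w (m + 1) + w (m - 1) + 2 * poisson 1 w m" if "m > 0" for m
      proof -
        have pw: "poisson 1 w m = poisson 1 v m + (- K) * poisson 1 b m"
          unfolding w_def by (rule poisson_linear[OF bound b_bound])
        have "4 * axis_fun x m = axis_fun x (m + 1) + axis_fun x (m - 1) + 2 * poisson 1 (axis_fun x) m"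
          using axis_fun_equation[OF x, of m] that by (simp add: axis_defect_def[OF x])
        then have "(- S) * (4 * axis_fun x m) = (- S) * (axis_fun x (m + 1) + axis_fun x (m - 1) + 2 * poisson 1 (axis_fun x) m)" by simp
        then have "4 * b m = b (m + 1) + b (m - 1) + 2 * poisson 1 b m"
          unfolding pb by (simp only: b_def distrib_left mult_ac)
        then have "(- K) * (4 * b m) = (- K) * (b (m + 1) + b (m - 1) + 2 * poisson 1 b m)" by simp
        then show ?thesis using harm[OF that] unfolding pw by (simp only: w_def distrib_left mult_ac)
      qed
    qed
    then show ?thesis by (simp add: w_def b_def S_def)
  qed
  \<comment> \<open>Only now does \<open>x\<close> move: at fixed \<open>m\<close> the barrier tends
    to 0.\<close>
  have "((\<lambda>x. K * (1 - S_fun x * axis_fun x m)) \<longlongrightarrow> K * (1 - 1)) (at_left 1)"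
    by (intro tendsto_intros axis_fun_tendsto_1)
  moreover have "eventually (\<lambda>x. v m \<le> K * (1 - S_fun x * axis_fun x m)) (at_left 1)"
    unfolding eventually_at_left[OF zero_less_one] using le by (intro exI[of _ 0]) auto
  ultimately have "v m \<le> K * (1 - 1)" by (intro tendsto_lowerbound) auto
  then show ?thesis by simp
qed

lemma axis_unique:
  fixes v :: "int \<Rightarrow> real"
  assumes bound: "\<And>m. \<bar>v m\<bar> \<le> M"
    and zero: "\<And>m. m \<le> 0 \<Longrightarrow> v m = 0"
    and harm: "\<And>m. m > 0 \<Longrightarrow> 4 * v m = v (m + 1) + v (m - 1) + 2 * poisson 1 v m"
  shows "v m = 0"
proof -
  have neg: "poisson 1 (\<lambda>m. - v m) m = - poisson 1 v m" for m
    by (simp add: poisson_def infsum_uminus)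
  have "- v m \<le> 0"
    by (rule axis_nonpos[where M = M]) (use bound zero harm neg in auto)
  moreover have "v m \<le> 0" by (rule axis_nonpos[OF assms])
  ultimately show ?thesis by simp
qed


section \<open>Hitting probabilities of the slit\<close>

lemma first_hit_nonneg: "0 \<le> first_hit n s t"
  by (induction n s t rule: first_hit.induct) auto

lemma first_hit_sum_le_1: "finite T \<Longrightarrow> (\<Sum>n<N. \<Sum>t\<in>T. first_hit n s t) \<le> 1"
proof (induction N arbitrary: s)
  case (Suc N)
  have split: "(\<Sum>n<Suc N. \<Sum>t\<in>T. first_hit n s t) = (\<Sum>t\<in>T. first_hit 0 s t) + (\<Sum>n<N. \<Sum>t\<in>T. first_hit (Suc n) s t)"
    by (rule sum.lessThan_Suc_shift)
  show ?case
  proof (cases "s \<in> Hset")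
    case True
    then show ?thesis unfolding split using Suc.prems by simp
  next
    case False
    define A where "A s = (\<Sum>n<N. \<Sum>t\<in>T. first_hit n s t)" for s
    have "(\<Sum>n<N. \<Sum>t\<in>T. first_hit (Suc n) s t)
       = (A (fst s + 1, snd s) + A (fst s - 1, snd s) + A (fst s, snd s + 1) + A (fst s, snd s - 1)) / 4"
      using False by (simp add: A_def sum.distrib flip: sum_divide_distrib)
    also have "\<dots> \<le> (1 + 1 + 1 + 1) / 4"
      unfolding A_def by (intro divide_right_mono add_mono Suc.IH Suc.prems) simp
    finally show ?thesis unfolding split using False by simp
  qed
qed simp

lemma summable_first_hit: "summable (\<lambda>n. first_hit n s t)"
proof (rule summableI_nonneg_bounded)
  show "(\<Sum>n<N. first_hit n s t) \<le> 1" for N using first_hit_sum_le_1[of "{t}" s N] by simp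
qed (rule first_hit_nonneg)

lemma hitp_nonneg: "0 \<le> hitp i j k"
  unfolding hitp_def by (rule suminf_nonneg[OF summable_first_hit]) (rule first_hit_nonneg)

lemma hitp_sum_le_1: "(\<Sum>k<K. hitp i j k) \<le> 1"
proof -
  define T where "T = (\<lambda>k. (- int k, 0::int)) ` {..<K}"
  have "(\<lambda>N. \<Sum>n<N. \<Sum>k<K. first_hit n (i, j) (- int k, 0)) \<longlonglongrightarrow> (\<Sum>k<K. hitp i j k)"
    unfolding hitp_def
    by (subst sum.swap) (intro tendsto_sum summable_LIMSEQ summable_first_hit)
  moreover have "(\<Sum>n<N. \<Sum>k<K. first_hit n (i, j) (- int k, 0)) \<le> 1" for N
  proof -
    have "(\<Sum>k<K. first_hit n (i, j) (- int k, 0)) = (\<Sum>t\<in>T. first_hit n (i, j) t)" for n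
      unfolding T_def by (subst sum.reindex) (auto simp: inj_on_def)
    then show ?thesis using first_hit_sum_le_1[of T "(i, j)" N] by (simp add: T_def)
  qed
  ultimately show ?thesis by (intro LIMSEQ_le_const2) auto
qed

lemma summable_hitp: "summable (hitp i j)"
  by (rule summableI_nonneg_bounded[OF hitp_nonneg hitp_sum_le_1])

lemma hitp_harmonic:
  assumes "(i, j) \<notin> Hset"
  shows "4 * hitp i j k = hitp (i + 1) j k + hitp (i - 1) j k + hitp i (j + 1) k + hitp i (j - 1) k"
proof -
  let ?t = "(- int k, 0::int)"
  have "(\<lambda>n. first_hit n (i + 1, j) ?t + first_hit n (i - 1, j) ?t + first_hit n (i, j + 1) ?t + first_hit n (i, j - 1) ?t)
     sums (hitp (i + 1) j k + hitp (i - 1) j k + hitp i (j + 1) k + hitp i (j - 1) k)"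
    unfolding hitp_def by (intro sums_add summable_sums summable_first_hit)
  moreover have "first_hit n (i + 1, j) ?t + first_hit n (i - 1, j) ?t + first_hit n (i, j + 1) ?t + first_hit n (i, j - 1) ?t
     = 4 * first_hit (Suc n) (i, j) ?t" for n
    using assms by simp
  moreover have "(\<lambda>n. 4 * first_hit (Suc n) (i, j) ?t) sums (4 * hitp i j k)"
  proof (rule sums_mult)
    have "(\<lambda>n. first_hit n (i, j) ?t) sums hitp i j k"
      unfolding hitp_def by (rule summable_sums[OF summable_first_hit])
    \<comment> \<open>Off the slit the term \<open>n = 0\<close> vanishes, so shifting the index
      does not change the sum.\<close>
    moreover have "first_hit 0 (i, j) ?t = 0" using assms by simp
    ultimately show "(\<lambda>n. first_hit (Suc n) (i, j) ?t) sums hitp i j k"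
      using sums_Suc_iff[of "\<lambda>n. first_hit n (i, j) ?t" "hitp i j k"] by (simp del: first_hit.simps)
  qed
  ultimately show ?thesis by (simp only: sums_unique2)
qed

lemma hitp_boundary:
  assumes "i \<le> 0"
  shows "hitp i 0 k = (if k = nat (- i) then 1 else 0)"
proof -
  have H: "(i, 0) \<in> Hset" using assms by (auto simp: Hset_def)
  have "first_hit n (i, 0) (- int k, 0) = 0" if "n \<notin> {0}" for n
    using that H by (cases n) auto
  then have "hitp i 0 k = (\<Sum>n\<in>{0}. first_hit n (i, 0) (- int k, 0))"
    unfolding hitp_def by (intro suminf_finite) auto
  then show ?thesis using H assms by auto
qed

text \<open>Reflection in the axis preserves the slit. It makes the neighbours above and below an
  axis point contribute equally, whence the factor 2 in front of \<open>poisson 1\<close>.\<close>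

lemma first_hit_sym: "first_hit n (i, - j) (a, 0) = first_hit n (i, j) (a, 0)"
proof (induction n arbitrary: i j)
  case 0
  then show ?case by (auto simp: Hset_def)
next
  case (Suc n)
  have "(i, - j) \<in> Hset \<longleftrightarrow> (i, j) \<in> Hset" by (auto simp: Hset_def)
  moreover have "- j + 1 = - (j - 1)" "- j - 1 = - (j + 1)" by auto
  ultimately show ?case using Suc[of "i + 1" j] Suc[of "i - 1" j] Suc[of i "j - 1"] Suc[of i "j + 1"]
    by (simp only: first_hit.simps fst_conv snd_conv add_ac)
qed

lemma hitp_sym: "hitp i (- j) k = hitp i j k"
  by (simp add: hitp_def first_hit_sym)

section \<open>Generating functions at real points of (0, 1)\<close>

definition hit_gf :: "real \<Rightarrow> int \<Rightarrow> int \<Rightarrow> real" where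
  "hit_gf x i j = (\<Sum>k. hitp i j k * x ^ k)"

lemma hit_gf_sym: "hit_gf x i (- j) = hit_gf x i j"
  by (simp add: hit_gf_def hitp_sym)

context
  fixes x :: real
  assumes x: "0 < x" "x < 1"
begin

lemma hit_gf_sums: "(\<lambda>k. hitp i j k * x ^ k) sums hit_gf x i j"
  unfolding hit_gf_def
proof (rule summable_sums, rule summable_comparison_test'[OF summable_hitp])
  show "norm (hitp i j k * x ^ k) \<le> hitp i j k" for k
    using x hitp_nonneg[of i j k] by (simp add: mult_left_le power_le_one)
qed

lemma hit_gf_nonneg: "0 \<le> hit_gf x i j"
  unfolding hit_gf_def using hit_gf_sums x by (intro suminf_nonneg) (auto simp: hitp_nonneg sums_iff)

lemma hit_gf_le_1: "hit_gf x i j \<le> 1"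
proof -
  have "hit_gf x i j \<le> (\<Sum>k. hitp i j k)"
    unfolding hit_gf_def
    by (rule suminf_le) (use x hitp_nonneg in \<open>auto simp: mult_left_le power_le_one summable_hitp sums_summable[OF hit_gf_sums]\<close>)
  also have "\<dots> \<le> 1" by (rule suminf_le_const[OF summable_hitp hitp_sum_le_1])
  finally show ?thesis .
qed

lemma hit_gf_bound: "\<bar>hit_gf x i j\<bar> \<le> 1"
  using hit_gf_nonneg hit_gf_le_1 by simp

lemma hit_gf_harmonic:
  assumes "(i, j) \<notin> Hset"
  shows "4 * hit_gf x i j = hit_gf x (i + 1) j + hit_gf x (i - 1) j + hit_gf x i (j + 1) + hit_gf x i (j - 1)"
proof -
  have "(\<lambda>k. hitp (i + 1) j k * x ^ k + hitp (i - 1) j k * x ^ k + hitp i (j + 1) k * x ^ k + hitp i (j - 1) k * x ^ k)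
     sums (hit_gf x (i + 1) j + hit_gf x (i - 1) j + hit_gf x i (j + 1) + hit_gf x i (j - 1))"
    by (intro sums_add hit_gf_sums)
  moreover have "hitp (i + 1) j k * x ^ k + hitp (i - 1) j k * x ^ k + hitp i (j + 1) k * x ^ k + hitp i (j - 1) k * x ^ k
     = 4 * (hitp i j k * x ^ k)" for k
    unfolding mult.assoc[symmetric] hitp_harmonic[OF assms] by (simp only: distrib_right)
  moreover have "(\<lambda>k. 4 * (hitp i j k * x ^ k)) sums (4 * hit_gf x i j)" by (intro sums_mult hit_gf_sums)
  ultimately show ?thesis by (simp only: sums_unique2)
qed

lemma hit_gf_boundary:
  assumes "i \<le> 0"
  shows "hit_gf x i 0 = x ^ nat (- i)"
proof -
  have "hit_gf x i 0 = (\<Sum>k\<in>{nat (- i)}. hitp i 0 k * x ^ k)"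
    unfolding hit_gf_def by (rule suminf_finite) (auto simp: hitp_boundary[OF assms])
  then show ?thesis by (simp add: hitp_boundary[OF assms])
qed

text \<open>The open upper half-plane avoids the slit, so harmonicity holds at each of its points
  and the half-plane representation applies.\<close>

lemma hit_gf_row_1: "hit_gf x m 1 = poisson 1 (\<lambda>m. hit_gf x m 0) m"
proof -
  have "hit_gf x m (int 1) = poisson 1 (\<lambda>m. hit_gf x m (int 0)) m"
  proof (rule half_plane_poisson[where F = "\<lambda>m j. hit_gf x m (int j)"])
    show "\<bar>hit_gf x m (int j)\<bar> \<le> 1" for m j by (rule hit_gf_bound)
    show "4 * hit_gf x m (int (Suc j)) = hit_gf x (m + 1) (int (Suc j)) + hit_gf x (m - 1) (int (Suc j)) +
       hit_gf x m (int (Suc (Suc j))) + hit_gf x m (int j)" for m j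
    proof -
      have "(m, int (Suc j)) \<notin> Hset" by (auto simp: Hset_def)
      moreover have "int (Suc j) + 1 = int (Suc (Suc j))" "int (Suc j) - 1 = int j" by auto
      ultimately show ?thesis using hit_gf_harmonic[of m "int (Suc j)"] by metis
    qed
  qed
  then show ?thesis by simp
qed

text \<open>Both sides are bounded, equal \<open>x^(-m)\<close> on the slit and satisfy the same
  equation for \<open>m > 0\<close>; \<open>axis_unique\<close> applies to their difference.\<close>

lemma hit_gf_axis: "hit_gf x m 0 = S_fun x * axis_fun x m"
proof -
  obtain C where C: "\<And>m. \<bar>axis_fun x m\<bar> \<le> C" using axis_fun_bounded[OF x] by blast
  define S where "S = S_fun x"
  have S: "0 < S" using S_fun_pos[of x] x by (simp add: S_def)
  define v where "v m = hit_gf x m 0 + (- S) * axis_fun x m" for m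
  have "v m = 0"
  proof (rule axis_unique[where M = "1 + S * C"])
    show "\<bar>v m\<bar> \<le> 1 + S * C" for m
    proof -
      have "\<bar>v m\<bar> \<le> \<bar>hit_gf x m 0\<bar> + \<bar>(- S) * axis_fun x m\<bar>" unfolding v_def by linarith
      also have "\<bar>(- S) * axis_fun x m\<bar> \<le> S * C" using C[of m] S by (simp add: abs_mult)
      finally show ?thesis using hit_gf_bound[of m 0] by linarith
    qed
    show "v m = 0" if "m \<le> 0" for m
      using axis_fun_nonpos[OF x, of "nat (- m)"] that S by (simp add: v_def hit_gf_boundary S_def)
    show "4 * v m = v (m + 1) + v (m - 1) + 2 * poisson 1 v m" if "m > 0" for m
    proof -
      have pv: "poisson 1 v m = poisson 1 (\<lambda>m. hit_gf x m 0) m + (- S) * poisson 1 (axis_fun x) m"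
        unfolding v_def by (rule poisson_linear[OF hit_gf_bound C])
      have "(m, 0) \<notin> Hset" using that by (auto simp: Hset_def)
      from hit_gf_harmonic[OF this] have h: "4 * hit_gf x m 0 = hit_gf x (m + 1) 0 + hit_gf x (m - 1) 0 + 2 * poisson 1 (\<lambda>m. hit_gf x m 0) m"
        using hit_gf_row_1[of m] hit_gf_sym[of x m 1] by simp
      have "4 * axis_fun x m = axis_fun x (m + 1) + axis_fun x (m - 1) + 2 * poisson 1 (axis_fun x) m"
        using axis_fun_equation[OF x, of m] that by (simp add: axis_defect_def[OF x])
      then have "(- S) * (4 * axis_fun x m) = (- S) * (axis_fun x (m + 1) + axis_fun x (m - 1) + 2 * poisson 1 (axis_fun x) m)" by simp
      then show ?thesis using h unfolding pv by (simp only: v_def distrib_left mult_ac)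
    qed
  qed
  then show ?thesis by (simp add: v_def S_def)
qed

text \<open>The axis equation solved for its Poisson term. On the slit, where the generating
  function is not harmonic, the explicit defect is what makes this possible.\<close>

lemma hit_gf_row_1_eq:
  "2 * hit_gf x m 1 = 4 * hit_gf x m 0 - hit_gf x (m + 1) 0 - hit_gf x (m - 1) 0 - S_fun x * axis_defect x m"
proof -
  obtain C where C: "\<And>m. \<bar>axis_fun x m\<bar> \<le> C" using axis_fun_bounded[OF x] by blast
  have "poisson 1 (\<lambda>m. hit_gf x m 0) m = poisson 1 (\<lambda>m. 0 + S_fun x * axis_fun x m) m" by (simp add: hit_gf_axis)
  also have "\<dots> = poisson 1 (\<lambda>_. 0) m + S_fun x * poisson 1 (axis_fun x) m"
    by (rule poisson_linear[of _ 0 _ C]) (auto simp: C)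
  also have "\<dots> = S_fun x * poisson 1 (axis_fun x) m" by (simp add: poisson_def)
  finally have "hit_gf x m 1 = S_fun x * poisson 1 (axis_fun x) m" by (simp add: hit_gf_row_1)
  then show ?thesis unfolding axis_fun_equation[OF x, of m, symmetric] hit_gf_axis by (simp add: algebra_simps)
qed

end


section \<open>Algebraic form of the generating functions\<close>

lemma QSqrt2_Rats: "r \<in> \<rat> \<Longrightarrow> r \<in> QSqrt2"
  unfolding QSqrt2_def by (elim Rats_cases, intro CollectI, rule exI, rule exI[of _ 0]) simp

lemma QSqrt2_sqrt2: "sqrt 2 \<in> QSqrt2"
  unfolding QSqrt2_def by (rule CollectI, rule exI[of _ 0], rule exI[of _ 1]) simp

lemma QSqrt2_add: "a \<in> QSqrt2 \<Longrightarrow> b \<in> QSqrt2 \<Longrightarrow> a + b \<in> QSqrt2"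
  unfolding QSqrt2_def
proof clarify
  fix a b c d :: rat
  have "of_rat a + of_rat b * sqrt 2 + (of_rat c + of_rat d * sqrt 2) = of_rat (a + c) + of_rat (b + d) * sqrt 2"
    by (simp add: of_rat_add algebra_simps)
  then show "\<exists>a' b'. of_rat a + of_rat b * sqrt 2 + (of_rat c + of_rat d * sqrt 2) = of_rat a' + of_rat b' * sqrt 2 \<and> True"
    by blast
qed

lemma QSqrt2_mult: "a \<in> QSqrt2 \<Longrightarrow> b \<in> QSqrt2 \<Longrightarrow> a * b \<in> QSqrt2"
  unfolding QSqrt2_def
proof clarify
  fix a b c d :: rat
  have "(of_rat a + of_rat b * sqrt 2) * (of_rat c + of_rat d * sqrt 2)
      = of_rat (a * c + 2 * b * d) + of_rat (a * d + b * c) * sqrt 2"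
    by (simp add: of_rat_add of_rat_mult algebra_simps)
  then show "\<exists>a' b'. (of_rat a + of_rat b * sqrt 2) * (of_rat c + of_rat d * sqrt 2) = of_rat a' + of_rat b' * sqrt 2 \<and> True"
    by blast
qed

lemma QSqrt2_uminus: "a \<in> QSqrt2 \<Longrightarrow> - a \<in> QSqrt2"
  using QSqrt2_mult[OF QSqrt2_Rats[of "-1"]] by simp

lemma QSqrt2_0: "0 \<in> QSqrt2" and QSqrt2_1: "1 \<in> QSqrt2"
  by (simp_all add: QSqrt2_Rats)

lemma QSqrt2_sum: "(\<And>x. x \<in> A \<Longrightarrow> f x \<in> QSqrt2) \<Longrightarrow> sum f A \<in> QSqrt2"
  by (induction A rule: infinite_finite_induct) (auto simp: QSqrt2_0 QSqrt2_add)

lemma QSqrt2_power: "a \<in> QSqrt2 \<Longrightarrow> a ^ n \<in> QSqrt2"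
  by (induction n) (auto simp: QSqrt2_1 QSqrt2_mult)

lemma alpha_QSqrt2: "alpha \<in> QSqrt2"
  using QSqrt2_add[OF QSqrt2_Rats[of 3] QSqrt2_mult[OF QSqrt2_Rats[of "-2"] QSqrt2_sqrt2]]
  by (simp add: alpha_eq)

lemma binom_fps_QSqrt2:
  assumes "c \<in> \<rat>" "a \<in> QSqrt2"
  shows "binom_fps c a $ n \<in> QSqrt2"
proof -
  have "c gchoose n \<in> \<rat>"
  proof (induction n)
    case (Suc n)
    have "c gchoose Suc n = (c gchoose n) * ((c - of_nat n) / of_nat (Suc n))"
      using gbinomial_absorb_comp[of c n] gbinomial_absorption[of n c] by (simp add: field_simps)
    then show ?case using Suc assms(1) by (metis Rats_diff Rats_divide Rats_mult Rats_of_nat)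
  qed simp
  then show ?thesis
    unfolding binom_fps_def fps_nth_Abs_fps by (intro QSqrt2_mult QSqrt2_Rats QSqrt2_power QSqrt2_uminus assms(2))
qed

lemma S_fps_QSqrt2: "S_fps $ n \<in> QSqrt2"
  unfolding S_fps_def fps_mult_nth
  by (intro QSqrt2_sum QSqrt2_mult binom_fps_QSqrt2) (auto simp: alpha_QSqrt2 QSqrt2_1)

lemma R_fps_QSqrt2: "R_fps $ n \<in> QSqrt2"
  unfolding R_fps_def fps_mult_nth
  by (intro QSqrt2_sum QSqrt2_mult binom_fps_QSqrt2) (auto simp: alpha_QSqrt2 QSqrt2_1)

text \<open>Clearing the pole by \<open>x^N\<close> replaces Laurent polynomials by polynomials,
  with one \<open>N\<close> for \<open>f\<close> and \<open>g\<close>. Real points of (0, 1) suffice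
  because coefficients are compared later.\<close>

definition laurent_repr :: "(real \<Rightarrow> real) \<Rightarrow> nat \<Rightarrow> real poly \<Rightarrow> real poly \<Rightarrow> bool" where
  "laurent_repr F N P Q \<longleftrightarrow> (\<forall>n. coeff P n \<in> \<rat>) \<and> (\<forall>n. coeff Q n \<in> QSqrt2) \<and>
     (\<forall>x. 0 < x \<and> x < 1 \<longrightarrow> x ^ N * F x = poly P x - poly Q x * S_fun x)"

lemma laurent_repr_cong:
  assumes "laurent_repr F N P Q" "\<And>x. 0 < x \<Longrightarrow> x < 1 \<Longrightarrow> F x = G x"
  shows "laurent_repr G N P Q"
  using assms by (simp add: laurent_repr_def)

lemma laurent_repr_add:
  assumes F: "laurent_repr F N P Q" and G: "laurent_repr G M P' Q'"
  shows "laurent_repr (\<lambda>x. F x + G x) (N + M) (monom 1 M * P + monom 1 N * P') (monom 1 M * Q + monom 1 N * Q')"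
  unfolding laurent_repr_def
proof (intro conjI allI impI)
  show "coeff (monom 1 M * P + monom 1 N * P') n \<in> \<rat>" for n
    using F G by (auto simp: laurent_repr_def coeff_monom_mult)
  show "coeff (monom 1 M * Q + monom 1 N * Q') n \<in> QSqrt2" for n
    using F G by (auto simp: laurent_repr_def coeff_monom_mult intro!: QSqrt2_add QSqrt2_0)
  fix x :: real assume x: "0 < x \<and> x < 1"
  have "x ^ (N + M) * (F x + G x) = x ^ M * (x ^ N * F x) + x ^ N * (x ^ M * G x)"
    by (simp add: power_add algebra_simps)
  also have "\<dots> = x ^ M * (poly P x - poly Q x * S_fun x) + x ^ N * (poly P' x - poly Q' x * S_fun x)"
    using F G x by (simp add: laurent_repr_def)
  finally show "x ^ (N + M) * (F x + G x) = poly (monom 1 M * P + monom 1 N * P') x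
      - poly (monom 1 M * Q + monom 1 N * Q') x * S_fun x"
    by (simp add: poly_monom algebra_simps)
qed

lemma laurent_repr_cmult:
  assumes F: "laurent_repr F N P Q" and c: "c \<in> \<rat>"
  shows "laurent_repr (\<lambda>x. c * F x) N (smult c P) (smult c Q)"
  unfolding laurent_repr_def
proof (intro conjI allI impI)
  show "coeff (smult c P) n \<in> \<rat>" for n using F c by (auto simp: laurent_repr_def)
  show "coeff (smult c Q) n \<in> QSqrt2" for n 
    using F QSqrt2_Rats[OF c] by (auto simp: laurent_repr_def intro!: QSqrt2_mult)
  fix x :: real assume x: "0 < x \<and> x < 1"
  have "x ^ N * (c * F x) = c * (x ^ N * F x)" by simp
  also have "\<dots> = c * (poly P x - poly Q x * S_fun x)" using F x by (simp add: laurent_repr_def)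
  finally show "x ^ N * (c * F x) = poly (smult c P) x - poly (smult c Q) x * S_fun x" by (simp add: algebra_simps)
qed

text \<open>The number \<open>c\<close> records \<open>f(1)\<close>, so that the normalisation can
  be followed through linear combinations.\<close>

definition has_laurent_repr :: "real \<Rightarrow> (real \<Rightarrow> real) \<Rightarrow> bool" where
  "has_laurent_repr c F \<longleftrightarrow> (\<exists>N P Q. laurent_repr F N P Q \<and> poly P 1 = c)"

lemma has_laurent_repr_add: "has_laurent_repr c F \<Longrightarrow> has_laurent_repr d G \<Longrightarrow> has_laurent_repr (c + d) (\<lambda>x. F x + G x)"
  unfolding has_laurent_repr_def using laurent_repr_add by (fastforce simp: poly_monom)

lemma has_laurent_repr_cmult: "has_laurent_repr c F \<Longrightarrow> r \<in> \<rat> \<Longrightarrow> has_laurent_repr (r * c) (\<lambda>x. r * F x)"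
  unfolding has_laurent_repr_def using laurent_repr_cmult by fastforce

lemma has_laurent_repr_cong: "has_laurent_repr c F \<Longrightarrow> (\<And>x. 0 < x \<Longrightarrow> x < 1 \<Longrightarrow> F x = G x) \<Longrightarrow> c = d \<Longrightarrow> has_laurent_repr d G"
  unfolding has_laurent_repr_def using laurent_repr_cong by blast

text \<open>The second polynomial truncates the series of \<open>1/S\<close>. For
  \<open>n = 1\<close> only its constant term 1 remains, which gives
  \<open>f = g = 1/z\<close>.\<close>

lemma laurent_repr_hit_gf_axis_pos: "laurent_repr (\<lambda>x. hit_gf x (int n) 0) n 1 (\<Sum>l<n. monom (R_fps $ l) l)"
  unfolding laurent_repr_def
proof (intro conjI allI impI)
  show "coeff 1 k \<in> \<rat>" for k by (simp add: coeff_1)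
  show "coeff (\<Sum>l<n. monom (R_fps $ l) l) k \<in> QSqrt2" for k
    unfolding coeff_sum by (rule QSqrt2_sum) (auto simp: coeff_monom R_fps_QSqrt2 QSqrt2_0)
  fix x :: real assume x: "0 < x \<and> x < 1"
  then have S: "0 < S_fun x" using S_fun_pos[of x] by simp
  have "x ^ n * hit_gf x (int n) 0 = S_fun x * (x ^ n * axis_fun x (int n))" using x by (simp add: hit_gf_axis)
  also have "\<dots> = S_fun x * (inverse (S_fun x) - (\<Sum>l<n. R_fps $ l * x ^ l))" using x by (simp add: axis_fun_nonneg)
  also have "\<dots> = 1 - (\<Sum>l<n. R_fps $ l * x ^ l) * S_fun x" using S by (simp add: right_diff_distrib)
  finally show "x ^ n * hit_gf x (int n) 0 = poly 1 x - poly (\<Sum>l<n. monom (R_fps $ l) l) x * S_fun x"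
    by (simp add: poly_sum poly_monom)
qed

lemma has_laurent_repr_hit_gf_axis: "has_laurent_repr 1 (\<lambda>x. hit_gf x i 0)"
proof (cases "i \<le> 0")
  case True
  have "laurent_repr (\<lambda>x. hit_gf x i 0) 0 (monom 1 (nat (- i))) 0"
    unfolding laurent_repr_def using True by (auto simp: coeff_monom QSqrt2_0 hit_gf_boundary poly_monom)
  then show ?thesis unfolding has_laurent_repr_def by (auto simp: poly_monom intro!: exI)
next
  case False
  then show ?thesis
    unfolding has_laurent_repr_def using laurent_repr_hit_gf_axis_pos[of "nat i"] by (auto intro!: exI)
qed

text \<open>The defect enters only multiplied by \<open>S_fun\<close>, hence only into
  \<open>g\<close>; it leaves \<open>f\<close> rational in spite of the factor
  \<open>sqrt 2 + 1\<close> and contributes 0 to \<open>f(1)\<close>.\<close>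

lemma has_laurent_repr_axis_defect: "has_laurent_repr 0 (\<lambda>x. S_fun x * axis_defect x m)"
proof -
  define Q where "Q = (if m \<le> 0 then \<Sum>i\<le>nat (- m). monom (- (sqrt 2 + 1) * S_fps $ i) (nat (- m) - i) else 0)"
  have "laurent_repr (\<lambda>x. S_fun x * axis_defect x m) 0 0 Q"
    unfolding laurent_repr_def
  proof (intro conjI allI impI)
    show "coeff 0 k \<in> \<rat>" for k by simp
    have "- (sqrt 2 + 1) * S_fps $ i \<in> QSqrt2" for i
      by (intro QSqrt2_mult QSqrt2_uminus QSqrt2_add QSqrt2_sqrt2 QSqrt2_1 S_fps_QSqrt2)
    then show "coeff Q k \<in> QSqrt2" for k
      unfolding Q_def by (auto simp: coeff_sum coeff_monom QSqrt2_0 simp del: mult_minus_left intro!: QSqrt2_sum)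
    fix x :: real assume x: "0 < x \<and> x < 1"
    have "poly Q x = - axis_defect x m"
      using x by (simp add: Q_def axis_defect_def poly_sum poly_monom mult.assoc sum_distrib_left del: minus_add_distrib add_uminus_conv_diff flip: sum_negf)
    then show "x ^ 0 * (S_fun x * axis_defect x m) = poly 0 x - poly Q x * S_fun x" by simp
  qed
  then show ?thesis unfolding has_laurent_repr_def by fastforce
qed

text \<open>Both uses restore the value 1: \<open>d = 0\<close> followed by halving for row 1, and
  \<open>d = 1\<close> for the higher rows.\<close>

lemma has_laurent_repr_diff3:
  assumes "has_laurent_repr 1 F" "has_laurent_repr 1 G" "has_laurent_repr 1 H" "has_laurent_repr d K"
  shows "has_laurent_repr (2 - d) (\<lambda>x. 4 * F x - G x - H x - K x)"
proof -
  have "has_laurent_repr (4 * 1 + (-1) * 1 + (-1) * 1 + (-1) * d) (\<lambda>x. 4 * F x + (-1) * G x + (-1) * H x + (-1) * K x)"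
    by (intro has_laurent_repr_add has_laurent_repr_cmult assms) auto
  then show ?thesis by (rule has_laurent_repr_cong) auto
qed

text \<open>Harmonicity is a recursion of second order in \<open>j\<close>, so the induction carries
  two consecutive rows.\<close>

lemma has_laurent_repr_hit_gf_row: "has_laurent_repr 1 (\<lambda>x. hit_gf x i (int j)) \<and> has_laurent_repr 1 (\<lambda>x. hit_gf x i (int (Suc j)))"
proof (induction j arbitrary: i)
  case 0
  have "has_laurent_repr (1/2 * (2 - 0)) (\<lambda>x. 1/2 * (4 * hit_gf x i 0 - hit_gf x (i + 1) 0 - hit_gf x (i - 1) 0 - S_fun x * axis_defect x i))"
    by (intro has_laurent_repr_cmult has_laurent_repr_diff3 has_laurent_repr_hit_gf_axis has_laurent_repr_axis_defect) auto
  then have "has_laurent_repr 1 (\<lambda>x. hit_gf x i 1)"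
  proof (rule has_laurent_repr_cong)
    fix x :: real assume "0 < x" "x < 1"
    then show "1/2 * (4 * hit_gf x i 0 - hit_gf x (i + 1) 0 - hit_gf x (i - 1) 0 - S_fun x * axis_defect x i) = hit_gf x i 1"
      by (simp add: hit_gf_row_1_eq[symmetric])
  qed simp
  then show ?case using has_laurent_repr_hit_gf_axis by simp
next
  case (Suc j)
  have "has_laurent_repr (2 - 1) (\<lambda>x. 4 * hit_gf x i (int (Suc j)) - hit_gf x (i + 1) (int (Suc j)) - hit_gf x (i - 1) (int (Suc j)) - hit_gf x i (int j))"
    by (rule has_laurent_repr_diff3) (use Suc in blast)+
  then have "has_laurent_repr 1 (\<lambda>x. hit_gf x i (int (Suc (Suc j))))"
  proof (rule has_laurent_repr_cong)
    fix x :: real assume x: "0 < x" "x < 1"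
    have "(i, int (Suc j)) \<notin> Hset" by (auto simp: Hset_def)
    moreover have "int (Suc j) + 1 = int (Suc (Suc j))" "int (Suc j) - 1 = int j" by auto
    ultimately have "4 * hit_gf x i (int (Suc j)) = hit_gf x (i + 1) (int (Suc j)) + hit_gf x (i - 1) (int (Suc j)) +
       hit_gf x i (int (Suc (Suc j))) + hit_gf x i (int j)"
      using hit_gf_harmonic[OF x, of i "int (Suc j)"] by metis
    then show "4 * hit_gf x i (int (Suc j)) - hit_gf x (i + 1) (int (Suc j)) - hit_gf x (i - 1) (int (Suc j)) - hit_gf x i (int j)
       = hit_gf x i (int (Suc (Suc j)))" by linarith
  qed simp
  then show ?case using Suc by blast
qed

lemma has_laurent_repr_hit_gf: "has_laurent_repr 1 (\<lambda>x. hit_gf x i j)"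
proof (cases "j \<ge> 0")
  case True
  then show ?thesis using has_laurent_repr_hit_gf_row[of i "nat j"] by simp
next
  case False
  then show ?thesis using has_laurent_repr_hit_gf_row[of i "nat (- j)"] hit_gf_sym[of _ i j] by simp
qed

text \<open>In \<open>x^N (1 - F) = (x^N - P) + Q S\<close> the bracket has a factor
  \<open>1 - x\<close> because \<open>f(1) = 1\<close>, and \<open>(1 - x) / S_fun x\<close> tends
  to 0; only \<open>Q\<close> survives division by \<open>S\<close>.\<close>

lemma laurent_repr_limit:
  assumes r: "laurent_repr F N P Q" and P1: "poly P 1 = 1"
  shows "((\<lambda>x. (1 - F x) / S_fun x) \<longlongrightarrow> poly Q 1) (at_left 1)"
proof -
  have "poly (monom 1 N - P) 1 = 0" using P1 by (simp add: poly_monom)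
  then obtain T where T: "monom 1 N - P = [:-1, 1:] * T" unfolding poly_eq_0_iff_dvd by (auto elim: dvdE)
  have T': "x ^ N - poly P x = (1 - x) * (- poly T x)" for x
    using arg_cong[OF T, of "\<lambda>p. poly p x"] by (simp add: poly_monom algebra_simps)
  have "((\<lambda>x. (sqrt (1 - x) / sqrt (1 - alpha * x) * (- poly T x) + poly Q x) / x ^ N) \<longlongrightarrow>
     (sqrt (1 - 1) / sqrt (1 - alpha * 1) * (- poly T 1) + poly Q 1) / 1 ^ N) (at_left 1)"
    by (intro tendsto_intros) (use alpha_less_1 in auto)
  moreover have "eventually (\<lambda>x. (sqrt (1 - x) / sqrt (1 - alpha * x) * (- poly T x) + poly Q x) / x ^ N
     = (1 - F x) / S_fun x) (at_left 1)"
    using eventually_at_left_1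
  proof eventually_elim
    case (elim x)
    have S: "0 < S_fun x" using elim S_fun_pos[of x] by simp
    have "alpha * x < 1" using elim alpha_less_1 alpha_pos mult_less_cancel_left_pos[of alpha x 1] by linarith
    then have "sqrt (1 - x) / sqrt (1 - alpha * x) * S_fun x = 1 - x"
      using elim by (simp add: S_fun_def real_sqrt_mult)
    moreover have "(y * t + q) * S_fun x = (y * S_fun x) * t + q * S_fun x" for y t q
      by (simp add: algebra_simps)
    ultimately have "(sqrt (1 - x) / sqrt (1 - alpha * x) * (- poly T x) + poly Q x) * S_fun x
        = (1 - x) * (- poly T x) + poly Q x * S_fun x"
      by (simp only:)
    also have "\<dots> = x ^ N * (1 - F x)"
      using r elim unfolding T'[symmetric] laurent_repr_def by (simp add: algebra_simps)
    finally show ?case using S elim by (simp add: field_simps)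
  qed
  ultimately show ?thesis by (simp add: filterlim_cong)
qed

text \<open>Defining \<open>g(1)\<close> as a limit frees it from the choice of a representation, so
  sign and harmonicity can be read off from \<open>hit_gf\<close>.\<close>

definition decay_const :: "int \<Rightarrow> int \<Rightarrow> real" where
  "decay_const i j = Lim (at_left 1) (\<lambda>x. (1 - hit_gf x i j) / S_fun x)"

lemma decay_const_eq: "laurent_repr (\<lambda>x. hit_gf x i j) N P Q \<Longrightarrow> poly P 1 = 1 \<Longrightarrow> decay_const i j = poly Q 1"
  unfolding decay_const_def by (intro tendsto_Lim laurent_repr_limit) auto

lemma decay_const_tendsto: "((\<lambda>x. (1 - hit_gf x i j) / S_fun x) \<longlongrightarrow> decay_const i j) (at_left 1)"
  using has_laurent_repr_hit_gf[of i j] unfolding has_laurent_repr_def by (metis decay_const_eq laurent_repr_limit)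

lemma decay_const_nonneg: "0 \<le> decay_const i j"
proof (rule tendsto_lowerbound[OF decay_const_tendsto])
  show "eventually (\<lambda>x. 0 \<le> (1 - hit_gf x i j) / S_fun x) (at_left 1)"
    using eventually_at_left_1
  proof eventually_elim
    case (elim x)
    then show ?case using hit_gf_le_1[of x i j] S_fun_pos[of x] by simp
  qed
qed simp

lemma decay_const_harmonic:
  assumes "(i, j) \<notin> Hset"
  shows "4 * decay_const i j = decay_const (i + 1) j + decay_const (i - 1) j + decay_const i (j + 1) + decay_const i (j - 1)"
proof -
  let ?f = "\<lambda>i j x. (1 - hit_gf x i j) / S_fun x"
  have "((\<lambda>x. ?f (i + 1) j x + ?f (i - 1) j x + ?f i (j + 1) x + ?f i (j - 1) x) \<longlongrightarrow>
     decay_const (i + 1) j + decay_const (i - 1) j + decay_const i (j + 1) + decay_const i (j - 1)) (at_left 1)"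
    by (intro tendsto_add decay_const_tendsto)
  moreover have "eventually (\<lambda>x. ?f (i + 1) j x + ?f (i - 1) j x + ?f i (j + 1) x + ?f i (j - 1) x = 4 * ?f i j x) (at_left 1)"
    using eventually_at_left_1
  proof eventually_elim
    case (elim x)
    then have "4 * (1 - hit_gf x i j) = (1 - hit_gf x (i + 1) j) + (1 - hit_gf x (i - 1) j) + (1 - hit_gf x i (j + 1)) + (1 - hit_gf x i (j - 1))"
      using hit_gf_harmonic[of x i j] assms by simp
    then show ?case by (simp only: times_divide_eq_right add_divide_distrib)
  qed
  ultimately have "((\<lambda>x. 4 * ?f i j x) \<longlongrightarrow> decay_const (i + 1) j + decay_const (i - 1) j + decay_const i (j + 1) + decay_const i (j - 1)) (at_left 1)"
    by (rule Lim_transform_eventually)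
  moreover have "((\<lambda>x. 4 * ?f i j x) \<longlongrightarrow> 4 * decay_const i j) (at_left 1)" by (intro tendsto_mult_left decay_const_tendsto)
  ultimately show ?thesis by (intro tendsto_unique[of "at_left (1::real)"]) auto
qed

text \<open>Minimum principle: four nonnegative neighbour values sum to 0.\<close>

lemma decay_const_zero_spread:
  assumes "(i, j) \<notin> Hset" "decay_const i j = 0"
  shows "decay_const (i + 1) j = 0" "decay_const (i - 1) j = 0" "decay_const i (j + 1) = 0" "decay_const i (j - 1) = 0"
  using decay_const_harmonic[OF assms(1)] assms(2) decay_const_nonneg[of "i + 1" j] decay_const_nonneg[of "i - 1" j]
    decay_const_nonneg[of i "j + 1"] decay_const_nonneg[of i "j - 1"] by linarith+

lemma laurent_repr_hit_gf_1_0: "laurent_repr (\<lambda>x. hit_gf x 1 0) 1 1 1"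
  using laurent_repr_hit_gf_axis_pos[of 1] R_fps_0 by (simp add: monom_0 one_pCons)

text \<open>A zero would spread along a path avoiding the slit up to \<open>(1, 0)\<close>, where
  the value is 1: off the axis, along a row to column 1, then along that column.\<close>

lemma decay_const_nonzero:
  assumes "(i, j) \<notin> Hset"
  shows "decay_const i j \<noteq> 0"
proof
  assume z: "decay_const i j = 0"
  \<comment> \<open>A row with \<open>j' \<noteq> 0\<close> misses the slit entirely, so the zero
    can travel along it in both directions.\<close>
  obtain i' j' where "j' \<noteq> 0" and z': "decay_const i' j' = 0"
  proof (cases "j = 0")
    case True
    then show ?thesis using decay_const_zero_spread(3)[OF assms z] that[of 1 i] by simp
  next
    case False
    then show ?thesis using z that by blast
  qed
  have row: "decay_const (i' + int n) j' = 0 \<and> decay_const (i' - int n) j' = 0" for n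
  proof (induction n)
    case (Suc n)
    have notin: "(i' + int n, j') \<notin> Hset" "(i' - int n, j') \<notin> Hset" using \<open>j' \<noteq> 0\<close> by (auto simp: Hset_def)
    have "i' + int (Suc n) = i' + int n + 1" "i' - int (Suc n) = i' - int n - 1" by auto
    then show ?case using decay_const_zero_spread(1)[OF notin(1)] decay_const_zero_spread(2)[OF notin(2)] Suc by metis
  qed (simp add: z')
  have "decay_const 1 j' = 0"
  proof (cases "i' \<le> 1")
    case True
    then show ?thesis using row[of "nat (1 - i')"] by simp
  next
    case False
    then show ?thesis using row[of "nat (i' - 1)"] by simp
  qed
  then have col: "decay_const 1 (j' + int n) = 0 \<and> decay_const 1 (j' - int n) = 0" for n
  proof (induction n)
    case (Suc n)
    have notin: "(1, k) \<notin> Hset" for k by (auto simp: Hset_def)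
    have "j' + int (Suc n) = j' + int n + 1" "j' - int (Suc n) = j' - int n - 1" by auto
    then show ?case using decay_const_zero_spread(3)[OF notin, of "j' + int n"] decay_const_zero_spread(4)[OF notin, of "j' - int n"] Suc by metis
  qed simp
  have "decay_const 1 0 = 0"
  proof (cases "j' \<le> 0")
    case True
    then show ?thesis using col[of "nat (- j')"] by simp
  next
    case False
    then show ?thesis using col[of "nat j'"] by simp
  qed
  moreover have "decay_const 1 0 = 1" using decay_const_eq[OF laurent_repr_hit_gf_1_0] by simp
  ultimately show False by simp
qed


section \<open>Coefficients and asymptotics\<close>

text \<open>One-sided identity theorem: once the lower coefficients vanish, dividing by
  \<open>x^n\<close> and letting \<open>x\<close> decrease to 0 isolates the next one.\<close>

lemma real_powser_eq_0:
  fixes c :: "nat \<Rightarrow> real"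
  assumes "summable (\<lambda>n. \<bar>c n\<bar>)" "\<And>x. 0 < x \<Longrightarrow> x < 1 \<Longrightarrow> (\<Sum>n. c n * x ^ n) = 0"
  shows "c n = 0"
proof (induction n rule: less_induct)
  case (less n)
  define b where "b k = c (k + n)" for k
  have b: "summable (\<lambda>k. \<bar>b k\<bar>)" unfolding b_def using assms(1) summable_iff_shift[of "\<lambda>k. \<bar>c k\<bar>" n] by simp
  have sb: "summable (\<lambda>k. b k * x ^ k)" if "\<bar>x\<bar> \<le> 1" for x
  proof (rule summable_comparison_test'[OF b])
    show "norm (b k * x ^ k) \<le> \<bar>b k\<bar>" for k
      using that by (simp add: abs_mult power_abs mult_left_le power_le_one)
  qed
  have zero: "(\<Sum>k. b k * x ^ k) = 0" if x: "0 < x" "x < 1" for x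
  proof -
    have "summable (\<lambda>k. c k * x ^ k)"
      by (rule summable_comparison_test'[OF assms(1), where N = 0]) (use x in \<open>simp add: abs_mult mult_left_le power_le_one\<close>)
    then have "(\<lambda>k. c k * x ^ k) sums 0" using assms(2)[OF x] by (simp add: sums_iff)
    then have "(\<lambda>k. c (k + n) * x ^ (k + n)) sums (0 - (\<Sum>k<n. c k * x ^ k))"
      by (subst sums_iff_shift) simp
    then have "(\<lambda>k. x ^ n * (b k * x ^ k)) sums 0"
      using less by (simp add: b_def power_add mult_ac)
    then have "x ^ n * (\<Sum>k. b k * x ^ k) = 0"
      using sb[of x] x by (simp add: sums_iff suminf_mult)
    then show ?thesis using x by simp
  qed
  have "((\<lambda>x. \<Sum>k. b k * x ^ k) \<longlongrightarrow> b 0) (at 0)"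
    by (rule powser_limit_0[of 1]) (use sb in \<open>auto intro!: summable_sums\<close>)
  then have "((\<lambda>x. \<Sum>k. b k * x ^ k) \<longlongrightarrow> b 0) (at_right 0)"
    by (rule tendsto_within_subset) simp
  moreover have "eventually (\<lambda>x. (\<Sum>k. b k * x ^ k) = 0) (at_right 0)"
    unfolding eventually_at_right[OF zero_less_one] using zero by (auto intro!: exI[of _ 1])
  ultimately have "((\<lambda>_. 0::real) \<longlongrightarrow> b 0) (at_right (0::real))"
    by (simp add: Lim_transform_eventually)
  then show ?case by (simp add: b_def tendsto_const_iff)
qed

section \<open>From identities on (0, 1) to coefficients\<close>

lemma summable_fps_of_poly: "summable (\<lambda>n. \<bar>fps_of_poly (p :: real poly) $ n\<bar>)"
  by (rule summable_finite[of "{..degree p}"]) (auto simp: coeff_eq_0)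

lemma sums_fps_of_poly:
  "(\<lambda>n. of_real (fps_of_poly p $ n) * z ^ n) sums poly (map_poly of_real p) (z :: 'a :: real_normed_field)"
proof -
  have deg: "degree (map_poly of_real p :: 'a poly) = degree p" by (simp add: degree_map_poly)
  have "(\<lambda>n. of_real (fps_of_poly p $ n) * z ^ n) sums (\<Sum>n\<le>degree p. of_real (coeff p n) * z ^ n)"
    using sums_finite[of "{..degree p}" "\<lambda>n. of_real (fps_of_poly p $ n) * z ^ n"] by (simp add: coeff_eq_0)
  also have "(\<Sum>n\<le>degree p. of_real (coeff p n) * z ^ n) = poly (map_poly of_real p) z"
    by (simp add: poly_altdef deg coeff_map_poly)
  finally show ?thesis .
qed

definition hit_fps :: "int \<Rightarrow> int \<Rightarrow> real fps" where
  "hit_fps i j = Abs_fps (hitp i j)"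

lemma summable_hit_fps: "summable (\<lambda>n. \<bar>hit_fps i j $ n\<bar>)"
  using summable_hitp[of i j] hitp_nonneg by (simp add: hit_fps_def)

lemma map_poly_of_real_real: "map_poly of_real p = (p :: real poly)"
  by (rule poly_eqI) (simp add: coeff_map_poly)

lemma summable_fps_mult:
  fixes f g :: "real fps"
  assumes "summable (\<lambda>n. \<bar>f $ n\<bar>)" "summable (\<lambda>n. \<bar>g $ n\<bar>)"
  shows "summable (\<lambda>n. \<bar>(f * g) $ n\<bar>)"
proof -
  have "summable (\<lambda>n. \<Sum>i\<le>n. \<bar>f $ i\<bar> * \<bar>g $ (n - i)\<bar>)"
    using Cauchy_product_sums[of "\<lambda>n. \<bar>f $ n\<bar>" "\<lambda>n. \<bar>g $ n\<bar>"] assms by (simp add: sums_iff)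
  then show ?thesis
  proof (rule summable_comparison_test'[where N = 0])
    fix n
    have "\<bar>(f * g) $ n\<bar> \<le> (\<Sum>i\<le>n. \<bar>f $ i * g $ (n - i)\<bar>)" unfolding fps_mult_nth atLeast0AtMost by (rule sum_abs)
    then show "norm \<bar>(f * g) $ n\<bar> \<le> (\<Sum>i\<le>n. \<bar>f $ i\<bar> * \<bar>g $ (n - i)\<bar>)" by (simp add: abs_mult)
  qed
qed

text \<open>This leaves the interval (0, 1): the coefficient identity can be evaluated on the closed
  complex disc and read off for large indices.\<close>

lemma laurent_repr_fps:
  assumes "laurent_repr (\<lambda>x. hit_gf x i j) N P Q"
  shows "fps_of_poly (monom 1 N) * hit_fps i j = fps_of_poly P - S_fps * fps_of_poly Q"
proof -
  define L where "L = fps_of_poly (monom 1 N) * hit_fps i j"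
  define R where "R = S_fps * fps_of_poly Q"
  have sL: "summable (\<lambda>n. \<bar>L $ n\<bar>)" and sR: "summable (\<lambda>n. \<bar>R $ n\<bar>)"
    unfolding L_def R_def by (intro summable_fps_mult summable_fps_of_poly summable_hit_fps summable_S_fps)+
  define c where "c n = L $ n - (fps_of_poly P $ n - R $ n)" for n
  have "c n = 0" for n
  proof (rule real_powser_eq_0)
    have "summable (\<lambda>n. \<bar>L $ n\<bar> + (\<bar>fps_of_poly P $ n\<bar> + \<bar>R $ n\<bar>))"
      by (intro summable_add sL sR summable_fps_of_poly)
    then show "summable (\<lambda>n. \<bar>c n\<bar>)"
      by (rule summable_comparison_test'[where N = 0]) (auto simp: c_def)
    fix x :: real assume x: "0 < x" "x < 1"
    have 1: "(\<lambda>n. L $ n * x ^ n) sums (x ^ N * hit_gf x i j)"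
      using sums_fps_mult[OF summable_fps_of_poly[of "monom 1 N"] summable_hit_fps[of i j], of x] x
        sums_fps_of_poly[of "monom 1 N" x] hit_gf_sums[OF x, of i j]
      by (simp add: L_def sums_iff map_poly_of_real_real poly_monom hit_fps_def)
    have 2: "(\<lambda>n. R $ n * x ^ n) sums (S_fun x * poly Q x)"
      using sums_fps_mult[OF summable_S_fps summable_fps_of_poly[of Q], of x] x
        sums_fps_of_poly[of Q x] S_fps_sums[of x]
      by (simp add: R_def sums_iff map_poly_of_real_real)
    have 3: "(\<lambda>n. fps_of_poly P $ n * x ^ n) sums poly P x"
      using sums_fps_of_poly[of P x] by (simp add: map_poly_of_real_real)
    have "(\<lambda>n. L $ n * x ^ n - (fps_of_poly P $ n * x ^ n - R $ n * x ^ n)) sums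
       (x ^ N * hit_gf x i j - (poly P x - S_fun x * poly Q x))"
      by (intro sums_diff 1 2 3)
    moreover have "x ^ N * hit_gf x i j - (poly P x - S_fun x * poly Q x) = 0"
      using assms x by (simp add: laurent_repr_def mult.commute)
    ultimately show "(\<Sum>n. c n * x ^ n) = 0" by (simp add: c_def sums_iff left_diff_distrib)
  qed
  then have "L $ n = (fps_of_poly P - R) $ n" for n by (simp add: c_def)
  then have "L = fps_of_poly P - R" by (rule fps_ext)
  then show ?thesis by (simp add: L_def R_def)
qed

text \<open>All series involved have summable coefficients, so the coefficient identity may be
  evaluated at every \<open>z\<close> of the closed disc and then divided by
  \<open>z^N\<close>.\<close>

lemma hitp_complex_sums:
  fixes z :: complex
  assumes r: "laurent_repr (\<lambda>x. hit_gf x i j) N P Q" and z: "z \<noteq> 0" "norm z \<le> 1"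
  shows "(\<lambda>k. of_real (hitp i j k) * z ^ k) sums
     (laurent_eval (- int N) P z - laurent_eval (- int N) Q z *
        csqrt ((1 - z) * (1 - z * of_real ((sqrt 2 - 1)\<^sup>2))))"
proof -
  define C where "C = csqrt ((1 - z) * (1 - z * of_real ((sqrt 2 - 1)\<^sup>2)))"
  define F where "F = (\<Sum>k. of_real (hitp i j k) * z ^ k)"
  have sF: "(\<lambda>k. of_real (hitp i j k) * z ^ k) sums F"
    unfolding F_def
    by (rule summable_sums[OF summable_norm_cancel])
      (use summable_norm_fps_power[OF summable_hit_fps z(2), of i j] in \<open>simp add: hit_fps_def\<close>)
  have "(\<lambda>n. of_real ((fps_of_poly (monom 1 N) * hit_fps i j) $ n) * z ^ n) sums (z ^ N * F)"
    using sums_fps_mult[OF summable_fps_of_poly[of "monom 1 N"] summable_hit_fps[of i j] z(2)]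
      sums_fps_of_poly[of "monom 1 N" z]
    by (simp add: sums_iff F_def hit_fps_def map_poly_monom poly_monom)
  moreover have "(\<lambda>n. of_real (fps_of_poly P $ n) * z ^ n - of_real ((S_fps * fps_of_poly Q) $ n) * z ^ n)
     sums (poly (map_poly of_real P) z - C * poly (map_poly of_real Q) z)"
  proof (intro sums_diff sums_fps_of_poly)
    show "(\<lambda>n. of_real ((S_fps * fps_of_poly Q) $ n) * z ^ n) sums (C * poly (map_poly of_real Q) z)"
      using sums_fps_mult[OF summable_S_fps summable_fps_of_poly[of Q] z(2)] sums_fps_of_poly[of Q z] S_fps_sums_csqrt[OF z(2)]
      by (simp add: sums_iff C_def alpha_def)
  qed
  ultimately have "z ^ N * F = poly (map_poly of_real P) z - C * poly (map_poly of_real Q) z"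
    unfolding laurent_repr_fps[OF r] by (simp add: left_diff_distrib sums_unique2)
  then have "F = (poly (map_poly of_real P) z - C * poly (map_poly of_real Q) z) / z ^ N"
    using z by (simp add: field_simps)
  also have "\<dots> = laurent_eval (- int N) P z - laurent_eval (- int N) Q z * C"
    by (simp add: laurent_eval_def power_int_minus divide_inverse algebra_simps)
  finally show ?thesis using sF by (simp add: C_def)
qed

text \<open>Beyond the degree of \<open>P\<close> the hitting probabilities are the coefficients of
  \<open>- S Q\<close>, shifted by \<open>N\<close>; the polynomial factor scales the asymptotics of
  \<open>S\<close> by its value at 1.\<close>

lemma hitp_limit:
  assumes r: "laurent_repr (\<lambda>x. hit_gf x i j) N P Q"
  shows "(\<lambda>k. hitp i j k * real k powr (3/2)) \<longlonglongrightarrow> poly Q 1 * sqrt ((sqrt 2 - 1) / (2 * pi))"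
proof -
  define c where "c = sqrt ((sqrt 2 - 1) / (2 * pi))"
  have "(\<lambda>n. (S_fps * fps_of_poly Q) $ n * real (n + 1) powr (3/2)) \<longlonglongrightarrow> - c * (\<Sum>n. fps_of_poly Q $ n)"
    unfolding c_def
  proof (rule fps_mult_weighted_limit[OF _ S_fps_asymp])
    show "summable (\<lambda>n. \<bar>fps_of_poly Q $ n\<bar> * real (n + 1) powr (3/2))"
      by (rule summable_finite[of "{..degree Q}"]) (auto simp: coeff_eq_0)
  qed simp
  moreover have "(\<Sum>n. fps_of_poly Q $ n) = poly Q 1"
    using sums_fps_of_poly[of Q "1::real"] by (simp add: map_poly_of_real_real sums_iff)
  ultimately have "(\<lambda>n. (S_fps * fps_of_poly Q) $ n * real (n + 1) powr (3/2)) \<longlonglongrightarrow> - c * poly Q 1" by simp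
  then have "(\<lambda>k. (S_fps * fps_of_poly Q) $ (k + N) * real (k + N + 1) powr (3/2)) \<longlonglongrightarrow> - c * poly Q 1"
    by (rule LIMSEQ_ignore_initial_segment)
  moreover have "(\<lambda>k. (real k / real (k + N + 1)) powr (3/2)) \<longlonglongrightarrow> 1 powr (3/2)"
  proof (intro tendsto_powr tendsto_const)
    show "(\<lambda>k. real k / real (k + N + 1)) \<longlonglongrightarrow> 1" by real_asymp
  qed simp
  ultimately have "(\<lambda>k. - ((S_fps * fps_of_poly Q) $ (k + N) * real (k + N + 1) powr (3/2)) * (real k / real (k + N + 1)) powr (3/2))
     \<longlonglongrightarrow> - (- c * poly Q 1) * 1 powr (3/2)"
    by (intro tendsto_mult[OF tendsto_minus])
  moreover have "eventually (\<lambda>k. - ((S_fps * fps_of_poly Q) $ (k + N) * real (k + N + 1) powr (3/2)) * (real k / real (k + N + 1)) powr (3/2)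
     = hitp i j k * real k powr (3/2)) sequentially"
    using eventually_gt_at_top[of "degree P"]
  proof eventually_elim
    case (elim k)
    have "hitp i j k = (fps_of_poly (monom 1 N) * hit_fps i j) $ (k + N)"
      by (simp add: fps_of_poly_monom hit_fps_def fps_X_power_mult_nth)
    also have "\<dots> = - (S_fps * fps_of_poly Q) $ (k + N)"
      unfolding laurent_repr_fps[OF r] using elim by (simp add: coeff_eq_0)
    finally have "hitp i j k = - (S_fps * fps_of_poly Q) $ (k + N)" .
    moreover have "real (k + N + 1) powr (3/2) * (real k / real (k + N + 1)) powr (3/2) = real k powr (3/2)"
      by (subst powr_mult[symmetric]) auto
    ultimately show ?case by (simp add: mult.assoc del: of_nat_add of_nat_Suc)
  qed
  ultimately show ?thesis by (simp add: filterlim_cong c_def mult.commute)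
qed

text \<open>Eventually \<open>a k\<close> differs from \<open>L * (b k - b (Suc k))\<close> by at
  most \<open>e / 2\<close> times that difference, and over a tail these errors telescope to
  \<open>e / 2 * b k\<close>.\<close>

lemma tail_sum_stolz_cesaro:
  fixes a b :: "nat \<Rightarrow> real"
  assumes a: "summable a" and b0: "b \<longlonglongrightarrow> 0"
    and dec: "\<And>k. k \<ge> K \<Longrightarrow> b (Suc k) < b k"
    and lim: "(\<lambda>k. a k / (b k - b (Suc k))) \<longlonglongrightarrow> L"
  shows "(\<lambda>k. (\<Sum>l. a (l + k)) / b k) \<longlonglongrightarrow> L"
proof (rule LIMSEQ_I)
  fix e :: real assume e: "0 < e"
  obtain M where M: "\<And>k. k \<ge> M \<Longrightarrow> \<bar>a k / (b k - b (Suc k)) - L\<bar> < e / 2"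
    using LIMSEQ_D[OF lim, of "e / 2"] e by auto
  have "norm ((\<Sum>l. a (l + k)) / b k - L) < e" if k: "k \<ge> max K M" for k
  proof -
    have d: "(\<lambda>l. b (l + k) - b (Suc l + k)) sums (b (0 + k) - 0)"
      by (rule telescope_sums') (rule LIMSEQ_ignore_initial_segment[OF b0])
    have dpos: "0 < b (l + k) - b (Suc l + k)" for l using dec[of "l + k"] k by simp
    have "0 < b k" using suminf_pos[OF sums_summable[OF d] dpos] sums_unique[OF d] by simp
    have t: "(\<lambda>l. a (l + k)) sums (\<Sum>l. a (l + k))"
      using a summable_iff_shift[of a k] by (simp add: summable_sums)
    have diff: "(\<lambda>l. a (l + k) - L * (b (l + k) - b (Suc l + k))) sums ((\<Sum>l. a (l + k)) - L * (b (0 + k) - 0))"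
      by (intro sums_diff sums_mult t d)
    have bnd: "norm (a (l + k) - L * (b (l + k) - b (Suc l + k))) \<le> e / 2 * (b (l + k) - b (Suc l + k))" for l
    proof -
      let ?d = "b (l + k) - b (Suc l + k)"
      have "\<bar>a (l + k) / ?d - L\<bar> * ?d \<le> e / 2 * ?d"
        using M[of "l + k"] k dpos[of l] by (intro mult_right_mono) auto
      moreover have "\<bar>a (l + k) / ?d - L\<bar> * ?d = \<bar>(a (l + k) / ?d - L) * ?d\<bar>" using dpos[of l] by (simp only: abs_mult abs_of_pos)
      moreover have "(a (l + k) / ?d - L) * ?d = a (l + k) - L * ?d" using dpos[of l] by (simp add: left_diff_distrib)
      ultimately show ?thesis by simp
    qed
    have "(\<lambda>l. e / 2 * (b (l + k) - b (Suc l + k))) sums (e / 2 * (b (0 + k) - 0))" by (rule sums_mult[OF d])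
    then have "norm (\<Sum>l. a (l + k) - L * (b (l + k) - b (Suc l + k))) \<le> e / 2 * b k"
      using norm_suminf_le[of "\<lambda>l. a (l + k) - L * (b (l + k) - b (Suc l + k))" "\<lambda>l. e / 2 * (b (l + k) - b (Suc l + k))", OF bnd]
      by (simp add: sums_iff)
    then have "\<bar>(\<Sum>l. a (l + k)) - L * b k\<bar> \<le> e / 2 * b k" using diff by (simp add: sums_iff)
    then have "\<bar>(\<Sum>l. a (l + k)) - L * b k\<bar> / b k \<le> e / 2" using \<open>0 < b k\<close> by (simp add: pos_divide_le_eq)
    moreover have "(\<Sum>l. a (l + k)) / b k - L = ((\<Sum>l. a (l + k)) - L * b k) / b k" using \<open>0 < b k\<close> by (simp add: diff_divide_distrib)
    ultimately have "norm ((\<Sum>l. a (l + k)) / b k - L) \<le> e / 2" using \<open>0 < b k\<close> by simp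
    then show ?thesis using e by linarith
  qed
  then show "\<exists>N. \<forall>k\<ge>N. norm ((\<Sum>l. a (l + k)) / b k - L) < e" by blast
qed

lemma tail_sum_limit_powr:
  fixes a :: "nat \<Rightarrow> real"
  assumes a: "summable a" and lim: "(\<lambda>k. a k * real k powr (3/2)) \<longlonglongrightarrow> L"
  shows "(\<lambda>k. (\<Sum>l. a (l + k)) * real k powr (1/2)) \<longlonglongrightarrow> 2 * L"
proof -
  \<comment> \<open>Chosen so that \<open>b k - b (Suc k)\<close> is asymptotic to
    \<open>k^(-3/2)\<close>.\<close>
  define b where "b k = 2 * real k powr (-1/2)" for k
  have "(\<lambda>k. (\<Sum>l. a (l + k)) / b k) \<longlonglongrightarrow> L"
  \<comment> \<open>\<open>K = 1\<close> because \<open>0 powr s\<close> is 0, so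
    \<open>b 0 = 0\<close> breaks monotonicity at the start.\<close>
  proof (rule tail_sum_stolz_cesaro[OF a, where K = 1])
    show "b \<longlonglongrightarrow> 0" unfolding b_def by real_asymp
    show "b (Suc k) < b k" if "k \<ge> 1" for k unfolding b_def using that by (intro mult_strict_left_mono powr_less_mono2_neg) auto
    have "(\<lambda>k. (b k - b (Suc k)) * real k powr (3/2)) \<longlonglongrightarrow> 1" unfolding b_def by real_asymp
    then have "(\<lambda>k. (a k * real k powr (3/2)) / ((b k - b (Suc k)) * real k powr (3/2))) \<longlonglongrightarrow> L / 1"
      by (intro tendsto_divide lim) auto
    moreover have "eventually (\<lambda>k. (a k * real k powr (3/2)) / ((b k - b (Suc k)) * real k powr (3/2)) = a k / (b k - b (Suc k))) sequentially"
      using eventually_gt_at_top[of 0] by eventually_elim simp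
    ultimately show "(\<lambda>k. a k / (b k - b (Suc k))) \<longlonglongrightarrow> L" by (simp add: filterlim_cong)
  qed
  then have "(\<lambda>k. 2 * ((\<Sum>l. a (l + k)) / b k)) \<longlonglongrightarrow> 2 * L" by (rule tendsto_mult_left)
  moreover have "2 * (t / b k) = t * real k powr (1/2)" for t k
    by (simp add: b_def powr_minus_divide)
  ultimately show ?thesis by simp
qed

lemma asymp_equiv_powr:
  fixes f :: "nat \<Rightarrow> real"
  assumes "(\<lambda>k. f k * real k powr s) \<longlonglongrightarrow> c" "c \<noteq> 0"
  shows "f \<sim>[at_top] (\<lambda>k. c * real k powr (- s))"
proof (rule asymp_equivI')
  have "(\<lambda>k. f k * real k powr s / c) \<longlonglongrightarrow> c / c" by (intro tendsto_divide assms tendsto_const)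
  moreover have "f k * real k powr s / c = f k / (c * real k powr (- s))" for k by (simp add: powr_minus divide_simps)
  ultimately show "(\<lambda>k. f k / (c * real k powr (- s))) \<longlonglongrightarrow> 1" using assms(2) by simp
qed

theorem mainTheorem17:
  fixes i j :: int
  assumes "(i, j) \<notin> Hset"
  shows "\<exists>mf P mg Q.
     (\<forall>n. coeff P n \<in> \<rat>) \<and> (\<forall>n. coeff Q n \<in> QSqrt2) \<and>
     laurent_eval mf P (1::real) = 1 \<and> laurent_eval mg Q (1::real) \<noteq> 0 \<and>
     (\<forall>z::complex. z \<noteq> 0 \<and> norm z \<le> 1 \<longrightarrow>
        (\<lambda>k. complex_of_real (hitp i j k) * z ^ k) sums
          (laurent_eval mf P z - laurent_eval mg Q z *
             csqrt ((1 - z) * (1 - z * complex_of_real ((sqrt 2 - 1)^2))))) \<and>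
     (\<lambda>k. hitp i j k) \<sim>[at_top]
        (\<lambda>k. laurent_eval mg Q (1::real) * sqrt ((sqrt 2 - 1) / (2 * pi)) * real k powr (-3/2)) \<and>
     (\<lambda>k. \<Sum>l. hitp i j (l + k)) \<sim>[at_top]
        (\<lambda>k. laurent_eval mg Q (1::real) * sqrt (2 * (sqrt 2 - 1) / pi) * real k powr (-1/2)) \<and>
     ((i, j) = (1, 0) \<longrightarrow>
        (\<forall>z::complex. z \<noteq> 0 \<longrightarrow> laurent_eval mf P z = 1 / z \<and> laurent_eval mg Q z = 1 / z))"
proof -
  \<comment> \<open>At \<open>(1, 0)\<close> the explicit representation must be chosen, since the
    existence statement does not tie its polynomials to \<open>1/z\<close>.\<close>
  obtain N P Q where r: "laurent_repr (\<lambda>x. hit_gf x i j) N P Q" and P1: "poly P 1 = 1"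
    and special: "(i, j) = (1, 0) \<Longrightarrow> N = 1 \<and> P = 1 \<and> Q = 1"
  proof (cases "(i, j) = (1, 0)")
    case True
    then show ?thesis using that[of 1 1 1] laurent_repr_hit_gf_1_0 by simp
  next
    case False
    then show ?thesis using that has_laurent_repr_hit_gf[of i j] unfolding has_laurent_repr_def by blast
  qed
  have Q1: "poly Q 1 \<noteq> 0" using decay_const_nonzero[OF assms] decay_const_eq[OF r P1] by simp
  have ev: "laurent_eval m p (1::real) = poly p 1" for m p
    by (simp add: laurent_eval_def map_poly_of_real_real)
  define c where "c = sqrt ((sqrt 2 - 1) / (2 * pi))"
  have c: "0 < c" by (simp add: c_def)
  \<comment> \<open>Summing the tail doubles the constant; the 2 enters the root as 4.\<close>
  have c2: "sqrt (2 * (sqrt 2 - 1) / pi) = 2 * c"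
  proof -
    have "2 * c = sqrt 4 * sqrt ((sqrt 2 - 1) / (2 * pi))" by (simp add: c_def)
    also have "\<dots> = sqrt (4 * ((sqrt 2 - 1) / (2 * pi)))" by (simp only: real_sqrt_mult)
    also have "4 * ((sqrt 2 - 1) / (2 * pi)) = 2 * (sqrt 2 - 1) / pi" by (simp add: field_simps)
    finally show ?thesis by simp
  qed
  have lim: "(\<lambda>k. hitp i j k * real k powr (3/2)) \<longlonglongrightarrow> poly Q 1 * c"
    using hitp_limit[OF r] by (simp add: c_def)
  have "(\<lambda>k. \<Sum>l. hitp i j (l + k)) \<sim>[at_top] (\<lambda>k. 2 * (poly Q 1 * c) * real k powr (- (1/2)))"
    using tail_sum_limit_powr[OF summable_hitp lim] Q1 c by (intro asymp_equiv_powr) auto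
  then have asymp2: "(\<lambda>k. \<Sum>l. hitp i j (l + k)) \<sim>[at_top]
     (\<lambda>k. poly Q 1 * sqrt (2 * (sqrt 2 - 1) / pi) * real k powr (-1/2))"
    unfolding c2 by (simp add: mult_ac)
  have "hitp i j \<sim>[at_top] (\<lambda>k. poly Q 1 * c * real k powr (- (3/2)))"
    using Q1 c by (intro asymp_equiv_powr[OF lim]) auto
  then have asymp1: "(\<lambda>k. hitp i j k) \<sim>[at_top] (\<lambda>k. poly Q 1 * sqrt ((sqrt 2 - 1) / (2 * pi)) * real k powr (-3/2))"
    by (simp add: c_def)
  have sp: "laurent_eval (- int N) P z = 1 / z \<and> laurent_eval (- int N) Q z = 1 / z"
    if "(i, j) = (1, 0)" "z \<noteq> 0" for z :: complex
    using special[OF that(1)] by (simp add: laurent_eval_def power_int_minus divide_inverse map_poly_1)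
  have coeffs: "\<forall>n. coeff P n \<in> \<rat>" "\<forall>n. coeff Q n \<in> QSqrt2" using r by (simp_all add: laurent_repr_def)
  show ?thesis
    \<comment> \<open>The single exponent \<open>- N\<close> serves both Laurent
      polynomials.\<close>
    by (rule exI[of _ "- int N"], rule exI[of _ P], rule exI[of _ "- int N"], rule exI[of _ Q], unfold ev)
      (intro conjI coeffs P1 Q1 asymp1 asymp2 allI impI hitp_complex_sums[OF r] sp[THEN conjunct1] sp[THEN conjunct2]; simp)
qed

end
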